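(* Suppose that $A$ is a negative definite $2\times2$ matrix and let $F(x):=1+(Ax,x)$. Then there is no solution $w\in C^\infty(\mathbb R^2_+)$ of the equation $$\begin{cases}-\Delta w=Fe^{2w}&\text{in }\mathbb R^2_+,\\ \dfrac{\partial w}{\partial\nu}=e^{w}&\text{on }\partial\mathbb R^2_+,\end{cases}$$ with $w\le C$ for some constant $C$, such that $Fe^{2w}\in L^1(\mathbb R^2_+)$, $$\int_{\mathbb R^2_+}e^{2w}\,dx<\infty,\qquad \int_{\partial\mathbb R^2_+}e^{w}\,dl<\infty,\qquad\text{and}\qquad \int_{\mathbb R^2_+}Fe^{2w}\,dx\in\mathbb R.$$
   Context: $\mathbb R^2_+$ is the upper half-plane $\{(s,t)\in\mathbb R^2:t>0\}$, with functions in $C^\infty(\mathbb R^2_+)$ understood to be smooth up to the boundary $\partial\mathbb R^2_+=\{t=0\}$; $\nu=(0,-1)$ is the outward unit normal; $(\cdot,\cdot)$ is the Euclidean inner product on $\mathbb R^2$; $\Delta$ is the Euclidean Laplacian; $dl$ is arc length. *)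

theory Defs
  imports "HOL-Analysis.Analysis"
begin

definition upper_half_plane :: "(real^2) set" where
  "upper_half_plane = {x. x $ 2 > 0}"

definition closed_upper_half_plane :: "(real^2) set" where
  "closed_upper_half_plane = {x. x $ 2 \<ge> 0}"

definition bdry_upper_half_plane :: "(real^2) set" where
  "bdry_upper_half_plane = {x. x $ 2 = 0}"

definition outward_normal :: "real^2" where
  "outward_normal = vector [0, -1]"

text \<open>Symmetry is not required: the quadratic form of a matrix depends only on its symmetric part,
  so for statements about the form this agrees with the convention that includes symmetry.\<close>

definition negative_definite :: "real^'n^'n \<Rightarrow> bool" where
  "negative_definite A \<longleftrightarrow> (\<forall>x. x \<noteq> 0 \<longrightarrow> (A *v x) \<bullet> x < 0)"

text \<open>The derivative within \<open>S\<close> is unique at every point of \<open>S\<close> when \<open>S\<close> is open or the closed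
  half-plane, the only cases used; on the boundary of the latter it is the one-sided derivative.\<close>

definition partial_within :: "(real^'n) set \<Rightarrow> 'n \<Rightarrow> (real^'n \<Rightarrow> real) \<Rightarrow> real^'n \<Rightarrow> real" where
  "partial_within S i f x = frechet_derivative f (at x within S) (axis i 1)"

text \<open>All iterated partial derivatives exist and are differentiable, hence continuous, on \<open>S\<close>.
  For \<open>S\<close> the closed half-plane this is smoothness up to the boundary: all partial
  derivatives on the interior extend continuously to the closed half-plane.\<close>

definition smooth_within :: "(real^'n) set \<Rightarrow> (real^'n \<Rightarrow> real) \<Rightarrow> bool" where
  "smooth_within S f \<longleftrightarrow> (\<forall>is. foldr (partial_within S) is f differentiable_on S)"

definition laplacian :: "(real^'n \<Rightarrow> real) \<Rightarrow> real^'n \<Rightarrow> real" where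
  "laplacian f x = (\<Sum>i\<in>UNIV. partial_within UNIV i (partial_within UNIV i f) x)"

definition normal_derivative :: "(real^2 \<Rightarrow> real) \<Rightarrow> real^2 \<Rightarrow> real" where
  "normal_derivative f x =
    frechet_derivative f (at x within closed_upper_half_plane) outward_normal"

text \<open>The image of Lebesgue measure on the line under the unit-speed
  parametrisation \<open>s \<mapsto> (s, 0)\<close> of the boundary.\<close>

definition bdry_arc_length :: "(real^2) measure" where
  "bdry_arc_length = distr lborel borel (\<lambda>s. vector [s, 0])"

end

theory Submission
  imports Defs
begin

text \<open>In logarithmic polar coordinates, \<open>z(t,\<theta>) = w(e\<^sup>t cos \<theta>, e\<^sup>t sin \<theta>) + t\<close> solves on the strip
  \<open>\<real> \<times> [0,\<pi>]\<close> the equation \<open>z\<^sub>t\<^sub>t + z\<^sub>\<theta>\<^sub>\<theta> = - F e\<^bsup>2z\<^esup>\<close> with \<open>z\<^sub>\<theta> = \<mp> e\<^sup>z\<close> at the two ends.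
  The Pohozaev identity says that \<open>H = \<integral> (z\<^sub>t\<^sup>2 - z\<^sub>\<theta>\<^sup>2 + F e\<^bsup>2z\<^esup>) / 2 d\<theta> + e\<^bsup>z(t,0)\<^esup> + e\<^bsup>z(t,\<pi>)\<^esup>\<close>
  decreases strictly from its limit \<open>\<pi>/2\<close> at \<open>t = -\<infinity>\<close>, while integrability of \<open>|x|\<^sup>2 e\<^bsup>2w\<^esup>\<close> and
  Jensen's inequality force the mean slope \<open>p/\<pi>\<close> of \<open>z\<close> to be asymptotically at most \<open>-1\<close>, so that
  \<open>p\<^sup>2/(2\<pi>) \<ge> \<pi>/2 - o(1)\<close>. Hence the energy of the oscillation \<open>v = z - mean z\<close> over \<open>[S,T]\<close> grows at
  least linearly in \<open>T\<close>. On the other hand, testing the equation with \<open>v\<close>, and using that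
  \<open>v \<le> K (1 + t)\<close> since \<open>w\<close> is bounded above, this energy \<open>G\<close> satisfies
  \<open>G\<^sup>4 \<le> k (1 + t)\<^sup>2 G'\<^sup>3\<close>, which makes it infinite in finite time.\<close>

subsection \<open>Calculus on an interval\<close>

lemma continuous_on_slice:
  fixes f :: "real \<Rightarrow> real \<Rightarrow> real"
  assumes "continuous_on (UNIV \<times> S) (\<lambda>p. f (fst p) (snd p))"
  shows "continuous_on S (f t)"
proof -
  have "continuous_on S (\<lambda>x. f (fst (t, x)) (snd (t, x)))"
    by (rule continuous_on_compose2[OF assms, of S "\<lambda>x. (t, x)"]) (auto intro!: continuous_intros)
  then show ?thesis by simp
qed

lemma continuous_on_slice_fst:
  fixes f :: "real \<Rightarrow> real \<Rightarrow> real"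
  assumes "continuous_on (UNIV \<times> S) (\<lambda>p. f (fst p) (snd p))" "x \<in> S"
  shows "continuous_on T (\<lambda>t. f t x)"
proof -
  have "continuous_on T (\<lambda>t. f (fst (t, x)) (snd (t, x)))"
    by (rule continuous_on_compose2[OF assms(1), of T "\<lambda>t. (t, x)"]) (use assms(2) in \<open>auto intro!: continuous_intros\<close>)
  then show ?thesis by simp
qed

lemma parametric_integral_has_derivative:
  fixes f f' :: "real \<Rightarrow> real \<Rightarrow> real"
  assumes "\<And>t x. x \<in> {a..b} \<Longrightarrow> ((\<lambda>t. f t x) has_real_derivative f' t x) (at t)"
    and "\<And>t. continuous_on {a..b} (f t)"
    and "continuous_on (UNIV \<times> {a..b}) (\<lambda>p. f' (fst p) (snd p))"
  shows "((\<lambda>t. integral {a..b} (f t)) has_real_derivative integral {a..b} (f' t)) (at t)"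
  using leibniz_rule_field_derivative[of UNIV a b f f' t] assms
  by (auto simp: cbox_interval case_prod_unfold intro!: integrable_continuous_real)

lemma parametric_integral_continuous:
  fixes f :: "real \<Rightarrow> real \<Rightarrow> real"
  assumes "continuous_on (UNIV \<times> {a..b}) (\<lambda>p. f (fst p) (snd p))"
  shows "continuous_on T (\<lambda>t. integral {a..b} (f t))"
proof -
  have "continuous_on UNIV (\<lambda>t. integral (cbox a b) (f t))"
    by (rule integral_continuous_on_param) (use assms in \<open>auto simp: cbox_interval case_prod_unfold\<close>)
  then show ?thesis by (auto simp: cbox_interval intro: continuous_on_subset)
qed

text \<open>The integral of (s f - t g)^2 is a nonnegative quadratic form in (s, t), which bounds
  its mixed coefficient.\<close>

lemma integral_Cauchy_Schwarz:
  fixes f g :: "real \<Rightarrow> real"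
  assumes "continuous_on {a..b} f" "continuous_on {a..b} g"
  shows "(integral {a..b} (\<lambda>x. f x * g x))\<^sup>2
    \<le> integral {a..b} (\<lambda>x. (f x)\<^sup>2) * integral {a..b} (\<lambda>x. (g x)\<^sup>2)"
proof -
  define P Q R where "P = integral {a..b} (\<lambda>x. (f x)\<^sup>2)" and "Q = integral {a..b} (\<lambda>x. (g x)\<^sup>2)"
    and "R = integral {a..b} (\<lambda>x. f x * g x)"
  have int: "(\<lambda>x. (f x)\<^sup>2) integrable_on {a..b}" "(\<lambda>x. (g x)\<^sup>2) integrable_on {a..b}"
      "(\<lambda>x. f x * g x) integrable_on {a..b}"
    by (auto intro!: integrable_continuous_real continuous_intros assms)
  have quad: "0 \<le> s\<^sup>2 * P - 2 * s * t * R + t\<^sup>2 * Q" for s t :: real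
  proof -
    have "((\<lambda>x. s\<^sup>2 * (f x)\<^sup>2 - 2 * s * t * (f x * g x) + t\<^sup>2 * (g x)\<^sup>2)
        has_integral (s\<^sup>2 * P - 2 * s * t * R + t\<^sup>2 * Q)) {a..b}"
      unfolding P_def Q_def R_def using int
      by (intro has_integral_add has_integral_diff has_integral_mult_right) (auto intro: integrable_integral)
    moreover have "0 \<le> s\<^sup>2 * (f x)\<^sup>2 - 2 * s * t * (f x * g x) + t\<^sup>2 * (g x)\<^sup>2" for x
    proof -
      have "s\<^sup>2 * (f x)\<^sup>2 - 2 * s * t * (f x * g x) + t\<^sup>2 * (g x)\<^sup>2 = (s * f x - t * g x)\<^sup>2"
        by (simp add: power2_eq_square algebra_simps)
      then show ?thesis by simp
    qed
    ultimately show ?thesis by (meson has_integral_nonneg)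
  qed
  have P0: "P \<ge> 0" and Q0: "Q \<ge> 0" using quad[of 1 0] quad[of 0 1] by auto
  have "R\<^sup>2 \<le> P * Q"
  proof (cases "Q = 0")
    case True
    have "0 \<le> P - 2 * t * R" for t using quad[of 1 t] True by simp
    \<comment> \<open>Unless \<open>R = 0\<close>, this \<open>t\<close> makes
      \<open>2 * t * R\<close> equal to \<open>P + 1\<close>, and the form would take the value
      -1.\<close>
    from this[of "(P + 1) * R / (2 * R\<^sup>2)"] have "R = 0"
      by (cases "R = 0") (auto simp: power2_eq_square)
    with True show ?thesis by simp
  next
    case False
    then have "Q > 0" using Q0 by simp
    have "0 \<le> Q * (P * Q - R\<^sup>2)" using quad[of Q R]
      by (simp add: power2_eq_square algebra_simps)
    then show ?thesis using \<open>Q > 0\<close> by (simp add: zero_le_mult_iff)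
  qed
  then show ?thesis by (simp add: P_def Q_def R_def)
qed

text \<open>The integrals over \<open>{0..T}\<close> increase with \<open>T\<close> and are bounded,
  so from some point on they lie within \<open>\<epsilon>\<close> of their supremum. The free lower
  bound \<open>S0\<close> allows a late start to be requested.\<close>

lemma bounded_integral_tail:
  fixes f :: "real \<Rightarrow> real"
  assumes cont: "continuous_on UNIV f" and nn: "\<And>t. f t \<ge> 0"
    and bdd: "\<And>T. T \<ge> 0 \<Longrightarrow> integral {0..T} f \<le> B" and "\<epsilon> > 0"
  obtains S where "S \<ge> S0" "S \<ge> 0" "\<And>T T'. S \<le> T \<Longrightarrow> T \<le> T' \<Longrightarrow> integral {T..T'} f \<le> \<epsilon>"
proof -
  have int: "f integrable_on {a..b}" for a b
    by (intro integrable_continuous_real continuous_on_subset[OF cont]) auto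
  have split: "integral {a..b} f + integral {b..c} f = integral {a..c} f" if "a \<le> b" "b \<le> c" for a b c
    using Henstock_Kurzweil_Integration.integral_combine[OF that int] .
  have pos: "integral {a..b} f \<ge> 0" for a b by (intro integral_nonneg int) (simp add: nn)
  define X where "X = (\<lambda>T. integral {0..T} f) ` {0..}"
  have "bdd_above X" "X \<noteq> {}" unfolding X_def using bdd by (auto intro!: bdd_aboveI[of _ B])
  then obtain y where "y \<in> X" "Sup X - \<epsilon> < y"
    using less_cSup_iff[of X "Sup X - \<epsilon>"] \<open>\<epsilon> > 0\<close> by auto
  then obtain T0 where T0: "T0 \<ge> 0" "Sup X - \<epsilon> < integral {0..T0} f" by (auto simp: X_def)
  show thesis
  proof (rule that[of "max S0 T0"])
    fix T T' assume T: "max S0 T0 \<le> T" "T \<le> T'"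
    then have "integral {0..T'} f \<le> Sup X" using T0 \<open>bdd_above X\<close>
      by (intro cSup_upper) (auto simp: X_def)
    moreover have "integral {0..T0} f + integral {T0..T} f = integral {0..T} f"
      "integral {0..T} f + integral {T..T'} f = integral {0..T'} f"
      using T T0 by (auto intro!: split)
    ultimately show "integral {T..T'} f \<le> \<epsilon>" using T0(2) pos[of T0 T] by linarith
  qed (use T0 in auto)
qed

lemma difference_le_integral:
  fixes f f' g :: "real \<Rightarrow> real"
  assumes "\<And>t. t \<in> {x..y} \<Longrightarrow> (f has_real_derivative f' t) (at t)"
    and "\<And>t. t \<in> {x..y} \<Longrightarrow> f' t \<le> g t" and "continuous_on {x..y} g" "x \<le> y"
  shows "f y - f x \<le> integral {x..y} g"
proof -
  have "(f' has_integral f y - f x) {x..y}"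
    using assms by (intro fundamental_theorem_of_calculus)
      (auto simp: has_real_derivative_iff_has_vector_derivative[symmetric] intro: DERIV_subset)
  then show ?thesis
    by (rule has_integral_le[OF _ integrable_integral[OF integrable_continuous_real]])
       (use assms in auto)
qed

text \<open>The inequality says that \<open>G t powr (-1/3)\<close> falls at least as fast as
  \<open>c * (1 + t) powr (1/3)\<close> rises. The latter is unbounded, so the former would have to
  become negative.\<close>

lemma superlinear_growth_impossible:
  fixes G e :: "real \<Rightarrow> real"
  assumes G: "\<And>t. t \<ge> T \<Longrightarrow> (G has_real_derivative e t) (at t)"
    and pos: "\<And>t. t \<ge> T \<Longrightarrow> G t > 0"
    and nn: "\<And>t. t \<ge> T \<Longrightarrow> e t \<ge> 0" and "k > 0" "T \<ge> 0"
    and le: "\<And>t. t \<ge> T \<Longrightarrow> (G t) ^ 4 \<le> k * (1 + t)\<^sup>2 * (e t) ^ 3"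
  shows False
proof -
  define c where "c = k powr (-1/3)"
  have "c > 0" using \<open>k > 0\<close> by (simp add: c_def)
  define \<phi> where "\<phi> t = G t powr (-1/3) + c * (1 + t) powr (1/3)" for t
  have d\<phi>: "(\<phi> has_real_derivative
      (-1/3 * G t powr (-4/3) * e t + c * (1/3) * (1 + t) powr (-2/3))) (at t)" if "t \<ge> T" for t
    unfolding \<phi>_def using that pos[OF that] \<open>T \<ge> 0\<close> G[OF that]
    by (auto intro!: derivative_eq_intros)
  have e_ge: "c * (1 + t) powr (-2/3) \<le> G t powr (-4/3) * e t" if "t \<ge> T" for t
  proof -
    have t: "1 + t > 0" "G t > 0" "e t \<ge> 0" using that \<open>T \<ge> 0\<close> pos nn by auto
    have "((G t) ^ 4) powr (1/3) \<le> (k * (1 + t)\<^sup>2 * (e t) ^ 3) powr (1/3)"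
      using le[OF that] t by (intro powr_mono2) auto
    moreover have "((G t) ^ 4) powr (1/3) = G t powr (4/3)"
      using t by (simp add: powr_powr flip: powr_numeral)
    moreover have "(k * (1 + t)\<^sup>2 * (e t) ^ 3) powr (1/3) = k powr (1/3) * (1 + t) powr (2/3) * e t"
      using t \<open>k > 0\<close> by (simp add: powr_mult powr_powr flip: powr_numeral)
    ultimately have *: "G t powr (4/3) \<le> k powr (1/3) * (1 + t) powr (2/3) * e t" by simp
    have "1 = G t powr (4/3) * G t powr (-4/3)" using t by (simp flip: powr_add)
    also have "\<dots> \<le> k powr (1/3) * (1 + t) powr (2/3) * e t * G t powr (-4/3)"
      by (intro mult_right_mono *) auto
    finally have "c * (1 + t) powr (-2/3) * 1
        \<le> c * (1 + t) powr (-2/3) * (k powr (1/3) * (1 + t) powr (2/3) * e t * G t powr (-4/3))"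
      using \<open>c > 0\<close> by (intro mult_left_mono) auto
    also have "\<dots> = (k powr (-1/3) * k powr (1/3)) * ((1 + t) powr (-2/3) * (1 + t) powr (2/3))
        * (G t powr (-4/3) * e t)"
      by (simp add: c_def mult_ac)
    also have "\<dots> = G t powr (-4/3) * e t" using t \<open>k > 0\<close> by (simp flip: powr_add)
    finally show ?thesis by simp
  qed
  have mono: "\<phi> t \<le> \<phi> T" if "t \<ge> T" for t
    by (rule DERIV_nonpos_imp_nonincreasing[OF that]) (use d\<phi> e_ge in force)
  \<comment> \<open>The second entry makes \<open>c * (1 + t) powr (1/3)\<close> at least
    \<open>\<phi> T + 1\<close>.\<close>
  define t where "t = max T (((\<phi> T + 1) / c) powr 3)"
  have \<phi>T: "\<phi> T \<ge> 0" unfolding \<phi>_def using \<open>c > 0\<close> by auto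
  have "(\<phi> T + 1) / c = (((\<phi> T + 1) / c) powr 3) powr (1/3)"
    unfolding powr_powr using \<phi>T \<open>c > 0\<close> by simp
  also have "\<dots> \<le> (1 + t) powr (1/3)" by (intro powr_mono2) (auto simp: t_def)
  finally have "\<phi> T + 1 \<le> c * (1 + t) powr (1/3)" using \<open>c > 0\<close> by (simp add: field_simps)
  also have "\<dots> \<le> \<phi> t" by (simp add: \<phi>_def)
  finally have "\<phi> T + 1 \<le> \<phi> t" .
  moreover have "t \<ge> T" by (simp add: t_def)
  ultimately show False using mono[of t] by linarith
qed

subsection \<open>The equation on the strip\<close>

text \<open>The subscripts \<open>t\<close> and \<open>h\<close> denote derivatives in \<open>t\<close> and in the angle \<open>\<theta>\<close>; \<open>a\<close> is the restriction of
  the quadratic form \<open>(Ax,x)\<close> to the unit circle.\<close>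

locale strip_solution =
  fixes z zt zh ztt zth zhh :: "real \<Rightarrow> real \<Rightarrow> real" and a :: "real \<Rightarrow> real"
    and \<alpha> \<beta> B C M :: real
  assumes cont: "continuous_on (UNIV \<times> {0..pi}) (\<lambda>p. z (fst p) (snd p))"
      "continuous_on (UNIV \<times> {0..pi}) (\<lambda>p. zt (fst p) (snd p))"
      "continuous_on (UNIV \<times> {0..pi}) (\<lambda>p. zh (fst p) (snd p))"
      "continuous_on (UNIV \<times> {0..pi}) (\<lambda>p. ztt (fst p) (snd p))"
      "continuous_on (UNIV \<times> {0..pi}) (\<lambda>p. zth (fst p) (snd p))"
      "continuous_on (UNIV \<times> {0..pi}) (\<lambda>p. zhh (fst p) (snd p))"
    and cont_a: "continuous_on {0..pi} a"
    and dz_t: "\<And>t \<theta>. \<theta> \<in> {0..pi} \<Longrightarrow> ((\<lambda>t. z t \<theta>) has_real_derivative zt t \<theta>) (at t)"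
    and dzt_t: "\<And>t \<theta>. \<theta> \<in> {0..pi} \<Longrightarrow> ((\<lambda>t. zt t \<theta>) has_real_derivative ztt t \<theta>) (at t)"
    and dzh_t: "\<And>t \<theta>. \<theta> \<in> {0..pi} \<Longrightarrow> ((\<lambda>t. zh t \<theta>) has_real_derivative zth t \<theta>) (at t)"
    and dz_h: "\<And>t \<theta>. \<theta> \<in> {0..pi} \<Longrightarrow> (z t has_real_derivative zh t \<theta>) (at \<theta> within {0..pi})"
    and dzh_h: "\<And>t \<theta>. \<theta> \<in> {0..pi} \<Longrightarrow> (zh t has_real_derivative zhh t \<theta>) (at \<theta> within {0..pi})"
    and eq: "\<And>t \<theta>. \<theta> \<in> {0..pi} \<Longrightarrow> ztt t \<theta> + zhh t \<theta> = - ((1 + exp (2 * t) * a \<theta>) * exp (2 * z t \<theta>))"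
    and bdry0: "\<And>t. zh t 0 = - exp (z t 0)"
    and bdry_pi: "\<And>t. zh t pi = exp (z t pi)"
    and a_bounds: "\<And>\<theta>. \<theta> \<in> {0..pi} \<Longrightarrow> - \<beta> \<le> a \<theta> \<and> a \<theta> \<le> - \<alpha>" and \<alpha>_pos: "\<alpha> > 0"
    and int_N: "\<And>T. T \<ge> 0 \<Longrightarrow> integral {0..T} (\<lambda>t. integral {0..pi} (\<lambda>\<theta>. exp (2 * z t \<theta>))) \<le> B"
    and int_J: "\<And>T. T \<ge> 0 \<Longrightarrow> integral {0..T} (\<lambda>t. integral {0..pi} (\<lambda>\<theta>. exp (2 * t) * exp (2 * z t \<theta>))) \<le> B"
    and int_b: "\<And>T. T \<ge> 0 \<Longrightarrow> integral {0..T} (\<lambda>t. exp (z t 0) + exp (z t pi)) \<le> B"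
    and z_le: "\<And>t \<theta>. \<theta> \<in> {0..pi} \<Longrightarrow> z t \<theta> \<le> C + t"
    and zt_lim: "\<And>t \<theta>. t \<le> 0 \<Longrightarrow> \<theta> \<in> {0..pi} \<Longrightarrow> \<bar>zt t \<theta> - 1\<bar> \<le> M * exp t"
begin

section \<open>Angular averages and the integrated equation\<close>

definition "F t \<theta> = 1 + exp (2 * t) * a \<theta>"
text \<open>Since dx is e^(2t) dt d\<theta> in these coordinates, \<open>N\<close>, \<open>J\<close>
  and \<open>b\<close> are the densities in \<open>t\<close> of the integrals of e^(2w), |x|^2
  e^(2w) and, along the boundary, e^w. \<open>q\<close> and \<open>p\<close> are \<open>pi\<close>
  times angular means.\<close>

definition "b t = exp (z t 0) + exp (z t pi)"
definition "N t = integral {0..pi} (\<lambda>\<theta>. exp (2 * z t \<theta>))"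
definition "J t = integral {0..pi} (\<lambda>\<theta>. exp (2 * t) * exp (2 * z t \<theta>))"
definition "q t = integral {0..pi} (z t)"
definition "p t = integral {0..pi} (zt t)"
definition "H t = (integral {0..pi} (\<lambda>\<theta>. (zt t \<theta>)\<^sup>2) - integral {0..pi} (\<lambda>\<theta>. (zh t \<theta>)\<^sup>2)) / 2
  + integral {0..pi} (\<lambda>\<theta>. F t \<theta> * exp (2 * z t \<theta>)) / 2 + b t"
definition "v t \<theta> = z t \<theta> - q t / pi"
definition "vt t \<theta> = zt t \<theta> - p t / pi"
definition "energy t = integral {0..pi} (\<lambda>\<theta>. (vt t \<theta>)\<^sup>2) + integral {0..pi} (\<lambda>\<theta>. (zh t \<theta>)\<^sup>2)"

lemma cont_a_snd: "continuous_on (UNIV \<times> {0..pi}) (\<lambda>p::real\<times>real. a (snd p))"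
  by (rule continuous_on_compose2[OF cont_a]) (auto intro!: continuous_intros)

lemmas cont_slice = cont[THEN continuous_on_slice]

lemma cont_slice0: "continuous_on T (\<lambda>t. z t 0)" "continuous_on T (\<lambda>t. z t pi)"
  by (rule continuous_on_slice_fst[OF cont(1)]; simp)+

lemmas cont_strip = cont cont_slice cont_slice0 cont_a cont_a_snd

lemma cont_F: "continuous_on (UNIV \<times> {0..pi}) (\<lambda>p. F (fst p) (snd p))" "continuous_on {0..pi} (F t)"
  unfolding F_def by (auto intro!: continuous_intros cont_strip)

lemma eq': "\<theta> \<in> {0..pi} \<Longrightarrow> ztt t \<theta> = - (F t \<theta> * exp (2 * z t \<theta>)) - zhh t \<theta>"
  using eq[of \<theta> t] by (simp add: F_def)

lemma cont_scalar:
  "continuous_on T b" "continuous_on T N" "continuous_on T J" "continuous_on T q" "continuous_on T p"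
  unfolding b_def N_def J_def q_def p_def
  by (auto intro!: continuous_intros parametric_integral_continuous cont_strip)

lemma \<beta>_pos: "\<beta> > 0"
  using a_bounds[of 0] \<alpha>_pos by auto

lemma b_nonneg: "b t \<ge> 0"
  by (simp add: b_def)

lemma N_nonneg: "N t \<ge> 0"
  unfolding N_def by (intro integral_nonneg integrable_continuous_real continuous_intros cont_strip) auto

lemma J_nonneg: "J t \<ge> 0"
  unfolding J_def by (intro integral_nonneg integrable_continuous_real continuous_intros cont_strip) auto

lemma J_eq: "J t = exp (2 * t) * N t"
  by (simp add: J_def N_def)

lemma integral_zhh: "integral {0..pi} (zhh t) = b t"
proof -
  have "(zhh t has_integral zh t pi - zh t 0) {0..pi}"
    using dzh_h by (intro fundamental_theorem_of_calculus) (auto simp: has_real_derivative_iff_has_vector_derivative)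
  then show ?thesis by (simp add: integral_unique bdry0 bdry_pi b_def)
qed

lemma F_bounds: "\<theta> \<in> {0..pi} \<Longrightarrow> - \<beta> * exp (2 * t) \<le> F t \<theta>" "\<theta> \<in> {0..pi} \<Longrightarrow> F t \<theta> \<le> 1"
  using a_bounds[of \<theta>] \<alpha>_pos mult_left_mono[of "-\<beta>" "a \<theta>" "exp (2 * t)"]
  by (auto simp: F_def mult_nonneg_nonpos) (simp add: algebra_simps)

lemma integral_F_bounds:
  "- \<beta> * J t \<le> integral {0..pi} (\<lambda>\<theta>. F t \<theta> * exp (2 * z t \<theta>))"
  "integral {0..pi} (\<lambda>\<theta>. F t \<theta> * exp (2 * z t \<theta>)) \<le> N t"
proof -
  have "integral {0..pi} (\<lambda>\<theta>. - \<beta> * (exp (2 * t) * exp (2 * z t \<theta>)))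
      \<le> integral {0..pi} (\<lambda>\<theta>. F t \<theta> * exp (2 * z t \<theta>))"
    by (intro integral_le integrable_continuous_real continuous_intros cont_strip cont_F)
       (use F_bounds(1) in \<open>simp only: mult.assoc[symmetric], intro mult_right_mono, auto\<close>)
  then show "- \<beta> * J t \<le> integral {0..pi} (\<lambda>\<theta>. F t \<theta> * exp (2 * z t \<theta>))"
    by (simp add: J_def)
  show "integral {0..pi} (\<lambda>\<theta>. F t \<theta> * exp (2 * z t \<theta>)) \<le> N t"
    unfolding N_def
    by (intro integral_le integrable_continuous_real continuous_intros cont_strip cont_F)
       (use F_bounds(2) in simp)
qed

lemma dq: "(q has_real_derivative p t) (at t)"
  unfolding q_def[abs_def] p_def by (intro parametric_integral_has_derivative dz_t cont_strip)

definition "p' t = - integral {0..pi} (\<lambda>\<theta>. F t \<theta> * exp (2 * z t \<theta>)) - b t"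

text \<open>Integrating the equation over the angle turns \<open>zhh\<close> into the boundary flux
  \<open>b\<close>.\<close>

lemma dp: "(p has_real_derivative p' t) (at t)"
proof -
  have "integral {0..pi} (ztt t) = integral {0..pi} (\<lambda>\<theta>. - (F t \<theta> * exp (2 * z t \<theta>)) - zhh t \<theta>)"
    by (intro integral_cong eq')
  also have "\<dots> = p' t"
    unfolding p'_def integral_zhh[symmetric]
    by (subst integral_diff) (auto intro!: integrable_continuous_real continuous_intros cont_strip cont_F)
  finally have "integral {0..pi} (ztt t) = p' t" .
  then show ?thesis
    unfolding p_def[abs_def] using parametric_integral_has_derivative[of 0 pi zt ztt t] dzt_t cont_strip by simp
qed

text \<open>As \<open>F\<close> lies between \<open>- \<beta> * exp (2 * t)\<close> and
  \<open>1\<close>, both signs of its integral are covered. The right side has bounded integrals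
  over \<open>t \<ge> 0\<close>, so the slope \<open>p\<close> has finite total variation
  there.\<close>

lemma p'_bound: "\<bar>p' t\<bar> \<le> \<beta> * J t + N t + b t"
proof -
  have "\<beta> * J t \<ge> 0" using J_nonneg \<beta>_pos by simp
  then show ?thesis
    unfolding p'_def using integral_F_bounds[of t] b_nonneg[of t] N_nonneg[of t] by auto
qed

text \<open>Symmetry of the mixed derivatives: differentiate \<open>z t x - z t 0 = \<integral> zh t\<close> in \<open>t\<close>, then in \<open>x\<close>.\<close>

lemma dzt_h:
  assumes "\<theta> \<in> {0..pi}"
  shows "(zt t has_real_derivative zth t \<theta>) (at \<theta> within {0..pi})"
proof -
  have *: "zt t x = zt t 0 + integral {0..x} (zth t)" if x: "x \<in> {0..pi}" for x
  proof -
    have sub: "{0..x} \<subseteq> {0..pi}" using x by auto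
    have "integral {0..x} (zh s) = z s x - z s 0" for s
    proof (intro integral_unique fundamental_theorem_of_calculus)
      show "(z s has_vector_derivative zh s y) (at y within {0..x})" if "y \<in> {0..x}" for y
        using DERIV_subset[OF dz_h sub] that x by (auto simp: has_real_derivative_iff_has_vector_derivative)
    qed (use x in auto)
    moreover have "((\<lambda>s. integral {0..x} (zh s)) has_real_derivative integral {0..x} (zth t)) (at t)"
    proof (rule parametric_integral_has_derivative)
      show "continuous_on (UNIV \<times> {0..x}) (\<lambda>p. zth (fst p) (snd p))"
        using sub by (auto intro!: continuous_on_subset[OF cont(5)])
    qed (use dzh_t x continuous_on_subset[OF cont_slice(3) sub] in auto)
    ultimately have "((\<lambda>s. z s x - z s 0) has_real_derivative integral {0..x} (zth t)) (at t)"
      by simp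
    moreover have "((\<lambda>s. z s x - z s 0) has_real_derivative zt t x - zt t 0) (at t)"
      by (intro DERIV_diff dz_t) (use x in auto)
    ultimately show ?thesis using DERIV_unique by fastforce
  qed
  have "((\<lambda>x. zt t 0 + integral {0..x} (zth t)) has_real_derivative zth t \<theta>) (at \<theta> within {0..pi})"
    using integral_has_real_derivative[OF cont_slice(5) assms] by (auto intro!: derivative_eq_intros)
  then show ?thesis
    by (rule has_field_derivative_transform_within[where d = 1]) (use assms *[symmetric] in auto)
qed

section \<open>The Pohozaev identity and the gap of \<open>H\<close> below
  \<open>pi / 2\<close>\<close>

lemma integral_zh_zth:
  "integral {0..pi} (\<lambda>\<theta>. zh t \<theta> * zth t \<theta> + zhh t \<theta> * zt t \<theta>)
    = exp (z t pi) * zt t pi + exp (z t 0) * zt t 0"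
proof -
  have "((\<lambda>\<theta>. zh t \<theta> * zth t \<theta> + zhh t \<theta> * zt t \<theta>) has_integral
      (zh t pi * zt t pi - zh t 0 * zt t 0)) {0..pi}"
  proof (rule fundamental_theorem_of_calculus)
    show "((\<lambda>\<theta>. zh t \<theta> * zt t \<theta>) has_vector_derivative (zh t \<theta> * zth t \<theta> + zhh t \<theta> * zt t \<theta>))
        (at \<theta> within {0..pi})" if "\<theta> \<in> {0..pi}" for \<theta>
      unfolding has_real_derivative_iff_has_vector_derivative[symmetric]
      using DERIV_mult'[OF dzh_h[OF that] dzt_h[OF that], of t t] by (simp add: algebra_simps)
  qed simp
  then show ?thesis by (simp add: integral_unique bdry0 bdry_pi)
qed

text \<open>What remains after differentiation is \<open>zt\<close> times the equation, which
  cancels, and the derivative of the explicit factor \<open>exp (2 * t)\<close> in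
  \<open>F\<close>.\<close>

lemma dH: "(H has_real_derivative integral {0..pi} (\<lambda>\<theta>. a \<theta> * exp (2 * t) * exp (2 * z t \<theta>))) (at t)"
proof -
  let ?I = "\<lambda>f. integral {0..pi} f"
  have d1: "((\<lambda>t. ?I (\<lambda>\<theta>. (zt t \<theta>)\<^sup>2)) has_real_derivative ?I (\<lambda>\<theta>. 2 * zt t \<theta> * ztt t \<theta>)) (at t)"
    by (rule parametric_integral_has_derivative)
       (auto intro!: derivative_eq_intros dzt_t continuous_intros cont_strip)
  have d2: "((\<lambda>t. ?I (\<lambda>\<theta>. (zh t \<theta>)\<^sup>2)) has_real_derivative ?I (\<lambda>\<theta>. 2 * zh t \<theta> * zth t \<theta>)) (at t)"
    by (rule parametric_integral_has_derivative)
       (auto intro!: derivative_eq_intros dzh_t continuous_intros cont_strip)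
  have d3: "((\<lambda>t. ?I (\<lambda>\<theta>. F t \<theta> * exp (2 * z t \<theta>))) has_real_derivative
      ?I (\<lambda>\<theta>. 2 * exp (2 * t) * a \<theta> * exp (2 * z t \<theta>) + F t \<theta> * (exp (2 * z t \<theta>) * (2 * zt t \<theta>)))) (at t)"
    unfolding F_def
    by (rule parametric_integral_has_derivative)
       (auto intro!: derivative_eq_intros dz_t continuous_intros cont_strip)
  have d4: "(b has_real_derivative exp (z t 0) * zt t 0 + exp (z t pi) * zt t pi) (at t)"
    unfolding b_def[abs_def] by (auto intro!: derivative_eq_intros dz_t)
  let ?D = "(?I (\<lambda>\<theta>. 2 * zt t \<theta> * ztt t \<theta>) - ?I (\<lambda>\<theta>. 2 * zh t \<theta> * zth t \<theta>)) / 2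
    + ?I (\<lambda>\<theta>. 2 * exp (2 * t) * a \<theta> * exp (2 * z t \<theta>) + F t \<theta> * (exp (2 * z t \<theta>) * (2 * zt t \<theta>))) / 2
    + (exp (z t 0) * zt t 0 + exp (z t pi) * zt t pi)"
  have "(H has_real_derivative ?D) (at t)"
    unfolding H_def[abs_def] by (intro DERIV_add DERIV_diff DERIV_cdivide d1 d2 d3 d4)
  moreover have "?D = ?I (\<lambda>\<theta>. a \<theta> * exp (2 * t) * exp (2 * z t \<theta>))"
  proof -
    \<comment> \<open>The boundary contributions are converted back into an integral by
      \<open>integral_zh_zth\<close>, so that all terms can be compared pointwise.\<close>
    have "?D = ?I (\<lambda>\<theta>. zt t \<theta> * ztt t \<theta>) - ?I (\<lambda>\<theta>. zh t \<theta> * zth t \<theta>)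
      + ?I (\<lambda>\<theta>. exp (2 * t) * a \<theta> * exp (2 * z t \<theta>) + F t \<theta> * (exp (2 * z t \<theta>) * zt t \<theta>))
      + ?I (\<lambda>\<theta>. zh t \<theta> * zth t \<theta> + zhh t \<theta> * zt t \<theta>)"
      unfolding integral_zh_zth diff_divide_distrib integral_divide[symmetric]
      by (simp add: algebra_simps add_divide_distrib)
    also have "\<dots> = ?I (\<lambda>\<theta>. zt t \<theta> * ztt t \<theta> - zh t \<theta> * zth t \<theta>
      + (exp (2 * t) * a \<theta> * exp (2 * z t \<theta>) + F t \<theta> * (exp (2 * z t \<theta>) * zt t \<theta>))
      + (zh t \<theta> * zth t \<theta> + zhh t \<theta> * zt t \<theta>))"
      by (subst integral_add integral_diff;
          (subst integral_add integral_diff)?;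
          (subst integral_add integral_diff)?;
          auto intro!: integrable_continuous_real continuous_intros cont_strip cont_F)+
    also have "\<dots> = ?I (\<lambda>\<theta>. a \<theta> * exp (2 * t) * exp (2 * z t \<theta>))"
      by (intro integral_cong) (simp add: eq' algebra_simps)
    finally show ?thesis .
  qed
  ultimately show ?thesis by metis
qed

lemma cont_v: "continuous_on (UNIV \<times> {0..pi}) (\<lambda>p. v (fst p) (snd p))"
  "continuous_on (UNIV \<times> {0..pi}) (\<lambda>p. vt (fst p) (snd p))"
  unfolding v_def vt_def
  by (intro continuous_intros cont_strip continuous_on_compose2[OF cont_scalar(4)[of UNIV]]
      continuous_on_compose2[OF cont_scalar(5)[of UNIV]]; simp)+

lemmas cont_v_slice = cont_v[THEN continuous_on_slice]

lemmas cont_all = cont_strip cont_F cont_v cont_v_slice cont_scalar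

lemma integral_v: "integral {0..pi} (v t) = 0" "integral {0..pi} (vt t) = 0"
  unfolding v_def vt_def
  by (subst integral_diff; auto intro!: integrable_continuous_real cont_all simp: q_def p_def)+

text \<open>Convexity: e^(2v) is at least 1 + 2v, and the linear term integrates to zero because
  \<open>v\<close> has mean zero.\<close>

lemma jensen: "pi * exp (2 * (q t / pi)) \<le> N t"
proof -
  have "integral {0..pi} (\<lambda>\<theta>. exp (2 * (q t / pi)) + 2 * exp (2 * (q t / pi)) * v t \<theta>) \<le> N t"
    unfolding N_def
  proof (intro integral_le integrable_continuous_real continuous_intros cont_all)
    fix \<theta> assume "\<theta> \<in> {0..pi}"
    have "exp (2 * (q t / pi)) * (1 + 2 * v t \<theta>) \<le> exp (2 * (q t / pi)) * exp (2 * v t \<theta>)"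
      using exp_ge_add_one_self[of "2 * v t \<theta>"] by (intro mult_left_mono) auto
    also have "\<dots> = exp (2 * z t \<theta>)" by (simp add: v_def algebra_simps flip: exp_add)
    finally show "exp (2 * (q t / pi)) + 2 * exp (2 * (q t / pi)) * v t \<theta> \<le> exp (2 * z t \<theta>)"
      by (simp add: algebra_simps)
  qed
  moreover have "integral {0..pi} (\<lambda>\<theta>. exp (2 * (q t / pi)) + 2 * exp (2 * (q t / pi)) * v t \<theta>)
      = pi * exp (2 * (q t / pi))"
    by (subst integral_add) (auto intro!: integrable_continuous_real continuous_intros cont_all simp: integral_v)
  ultimately show ?thesis by simp
qed

lemma N_pos: "N t > 0"
  using jensen[of t] by (rule less_le_trans[rotated]) simp

lemma dH_neg: "integral {0..pi} (\<lambda>\<theta>. a \<theta> * exp (2 * t) * exp (2 * z t \<theta>)) < 0"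
proof -
  have "integral {0..pi} (\<lambda>\<theta>. a \<theta> * exp (2 * t) * exp (2 * z t \<theta>))
      \<le> integral {0..pi} (\<lambda>\<theta>. - \<alpha> * exp (2 * t) * exp (2 * z t \<theta>))"
    by (intro integral_le integrable_continuous_real continuous_intros cont_all mult_right_mono)
       (use a_bounds in auto)
  also have "\<dots> = - \<alpha> * exp (2 * t) * N t" by (simp add: N_def)
  also have "\<dots> < 0" using \<alpha>_pos N_pos by (simp add: zero_less_mult_iff)
  finally show ?thesis .
qed

lemma H_decreasing: "s < t \<Longrightarrow> H t < H s"
  by (rule DERIV_neg_imp_decreasing) (use dH dH_neg in auto)

text \<open>The nonpositive contribution of \<open>zh\<close> is dropped. As \<open>s\<close> goes
  to minus infinity, \<open>zt\<close> tends to 1 and e^z to 0, so the bound tends to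
  \<open>pi / 2\<close>.\<close>

lemma H_upper:
  assumes "s \<le> 0"
  shows "H s \<le> pi * (1 + M * exp s)\<^sup>2 / 2 + pi * exp (2 * (C + s)) / 2 + 2 * exp (C + s)"
proof -
  let ?I = "\<lambda>f. integral {0..pi} f"
  have "?I (\<lambda>\<theta>. (zt s \<theta>)\<^sup>2) \<le> ?I (\<lambda>\<theta>. (1 + M * exp s)\<^sup>2)"
  proof (intro integral_le integrable_continuous_real continuous_intros cont_all)
    fix \<theta> assume "\<theta> \<in> {0..pi}"
    then have "\<bar>zt s \<theta> - 1\<bar> \<le> M * exp s" using zt_lim[OF assms] by blast
    then show "(zt s \<theta>)\<^sup>2 \<le> (1 + M * exp s)\<^sup>2" by (intro power2_le_iff_abs_le[THEN iffD2]) auto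
  qed
  moreover have "?I (\<lambda>\<theta>. (zh s \<theta>)\<^sup>2) \<ge> 0"
    by (intro integral_nonneg integrable_continuous_real continuous_intros cont_all) auto
  moreover have "?I (\<lambda>\<theta>. F s \<theta> * exp (2 * z s \<theta>)) \<le> ?I (\<lambda>\<theta>. exp (2 * (C + s)))"
  proof (intro integral_le integrable_continuous_real continuous_intros cont_all)
    fix \<theta> assume \<theta>: "\<theta> \<in> {0..pi}"
    have "F s \<theta> * exp (2 * z s \<theta>) \<le> 1 * exp (2 * z s \<theta>)"
      by (intro mult_right_mono F_bounds \<theta>) auto
    also have "\<dots> \<le> exp (2 * (C + s))" using z_le[OF \<theta>, of s] by simp
    finally show "F s \<theta> * exp (2 * z s \<theta>) \<le> exp (2 * (C + s))" .
  qed
  moreover have "exp (z s 0) + exp (z s pi) \<le> exp (C + s) + exp (C + s)"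
    using z_le[of 0 s] z_le[of pi s] by (intro add_mono) auto
  then have "b s \<le> 2 * exp (C + s)" by (simp add: b_def)
  ultimately show ?thesis unfolding H_def by (simp add: field_simps)
qed

text \<open>Monotonicity gives \<open>H (-1) \<le> pi / 2\<close> in the limit; the strict decrease
  from -1 to 0 then leaves the positive gap \<open>pi / 2 - H 0\<close>.\<close>

lemma H_gap: obtains \<delta> where "\<delta> > 0" "\<And>t. t \<ge> 0 \<Longrightarrow> H t \<le> pi / 2 - \<delta>"
proof
  let ?f = "\<lambda>s. pi * (1 + M * exp s)\<^sup>2 / 2 + pi * (exp (C + s) * exp (C + s)) / 2 + 2 * exp (C + s)"
  have e: "((\<lambda>s. exp (C + s)) \<longlongrightarrow> 0) at_bot"
    using tendsto_mult_left[OF exp_at_bot, of "exp C"] by (simp add: exp_add)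
  have "(?f \<longlongrightarrow> pi * (1 + M * 0)\<^sup>2 / 2 + pi * (0 * 0) / 2 + 2 * 0) at_bot"
    by (intro tendsto_intros e exp_at_bot) auto
  then have "(?f \<longlongrightarrow> pi / 2) at_bot" by simp
  moreover have "eventually (\<lambda>s. H (-1) \<le> ?f s) at_bot"
    using eventually_le_at_bot[of "-1"]
  proof eventually_elim
    case (elim s)
    have "H (-1) \<le> H s" using H_decreasing[of s "-1"] elim by (cases "s = -1") auto
    also have "\<dots> \<le> ?f s" using H_upper[of s] elim by (simp only: mult_2 exp_add)
    finally show ?case .
  qed
  ultimately have "H (-1) \<le> pi / 2" by (intro tendsto_lowerbound[of ?f _ at_bot]) auto
  then show "pi / 2 - H 0 > 0" using H_decreasing[of "-1" 0] by simp
  show "H t \<le> pi / 2 - (pi / 2 - H 0)" if "t \<ge> 0" for t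
    using H_decreasing[of 0 t] that by (cases "t = 0") auto
qed

section \<open>Slope of the mean and one-sided bound on the oscillation\<close>

text \<open>One integrable function dominates the derivative of \<open>p\<close> as well as
  \<open>\<beta> * J t\<close> and \<open>b t\<close>; the smallness of its tails controls all later
  error terms.\<close>

definition "g t = \<beta> * J t + N t + b t"

lemma cont_g: "continuous_on T g"
  unfolding g_def[abs_def] by (intro continuous_intros cont_all)

lemma g_ge: "\<beta> * J t \<le> g t" "b t \<le> g t" "g t \<ge> 0" "J t \<ge> 0"
  unfolding g_def using J_nonneg[of t] N_nonneg[of t] b_nonneg[of t] \<beta>_pos by auto

lemma int_g: "T \<ge> 0 \<Longrightarrow> integral {0..T} g \<le> (\<beta> + 2) * B"
proof -
  assume "T \<ge> 0"
  have "integral {0..T} g = \<beta> * integral {0..T} J + integral {0..T} N + integral {0..T} b"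
    unfolding g_def[abs_def]
    by (subst integral_add; (subst integral_add)?;
        auto intro!: integrable_continuous_real continuous_intros cont_all)+
  moreover have "\<beta> * integral {0..T} J \<le> \<beta> * B"
    using int_J[OF \<open>T \<ge> 0\<close>] \<beta>_pos by (intro mult_left_mono) (auto simp: J_def[abs_def])
  ultimately show ?thesis using int_N[OF \<open>T \<ge> 0\<close>] int_b[OF \<open>T \<ge> 0\<close>]
    by (simp add: N_def[abs_def] b_def[abs_def] algebra_simps)
qed

lemma p_diff:
  assumes "s \<le> t" shows "\<bar>p t - p s\<bar> \<le> integral {s..t} g"
proof -
  have "p t - p s \<le> integral {s..t} g"
    by (rule difference_le_integral[of _ _ _ p'])
       (use dp p'_bound assms cont_g in \<open>auto simp: g_def abs_le_iff\<close>)
  moreover have "- p t - - p s \<le> integral {s..t} g"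
  proof (rule difference_le_integral[of _ _ "\<lambda>t. - p t" "\<lambda>t. - p' t"])
    show "((\<lambda>t. - p t) has_real_derivative - p' x) (at x)" for x by (intro DERIV_minus dp)
    show "- p' x \<le> g x" for x using p'_bound[of x] by (simp add: g_def)
  qed (use assms cont_g in auto)
  ultimately show ?thesis by simp
qed

text \<open>Otherwise \<open>mean z + t\<close> is eventually nondecreasing, and by Jensen \<open>J\<close> is bounded away from zero,
  so not integrable.\<close>

lemma p_le:
  assumes tail: "\<And>T T'. S \<le> T \<Longrightarrow> T \<le> T' \<Longrightarrow> integral {T..T'} g \<le> \<epsilon>"
    and "S \<ge> 0" "S \<le> s"
  shows "p s \<le> - pi + \<epsilon>"
proof (rule ccontr)
  assume *: "\<not> p s \<le> - pi + \<epsilon>"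
  \<comment> \<open>After \<open>s\<close> the slope varies by at most \<open>\<epsilon>\<close>, so
    it stays above \<open>- pi\<close>.\<close>
  have "p t > - pi" if "t \<ge> s" for t
    using p_diff[OF that] tail[OF assms(3) that] * by linarith
  have "((\<lambda>t. q t + pi * t) has_real_derivative p t + pi) (at t)" for t
    by (auto intro!: derivative_eq_intros dq)
  then have q_mono: "q s + pi * s \<le> q t + pi * t" if "t \<ge> s" for t
    using that \<open>\<And>t. t \<ge> s \<Longrightarrow> p t > - pi\<close>
    by (intro DERIV_nonneg_imp_nondecreasing[of s t "\<lambda>t. q t + pi * t"]) force+
  define c where "c = pi * exp (2 * ((q s + pi * s) / pi))"
  have "c > 0" by (simp add: c_def)
  have J_ge: "c \<le> J t" if "t \<ge> s" for t
  proof -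
    have "c \<le> pi * exp (2 * ((q t + pi * t) / pi))"
      using q_mono[OF that] by (simp add: c_def divide_right_mono)
    also have "\<dots> = exp (2 * t) * (pi * exp (2 * (q t / pi)))"
      by (simp add: add_divide_distrib algebra_simps exp_add)
    also have "\<dots> \<le> J t" unfolding J_eq by (intro mult_left_mono jensen) auto
    finally show ?thesis .
  qed
  \<comment> \<open>This length makes the integral of the constant \<open>\<beta> * c\<close> equal
    to \<open>\<bar>\<epsilon>\<bar> + 1\<close>, more than the tail allows.\<close>
  define T where "T = s + (\<bar>\<epsilon>\<bar> + 1) / (\<beta> * c)"
  have "T \<ge> s" unfolding T_def using \<open>c > 0\<close> \<beta>_pos by auto
  have "integral {s..T} (\<lambda>t. \<beta> * c) \<le> integral {s..T} g"
  proof (intro integral_le integrable_continuous_real continuous_intros cont_g)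
    fix x assume "x \<in> {s..T}"
    then have "\<beta> * c \<le> \<beta> * J x" using J_ge \<beta>_pos by auto
    then show "\<beta> * c \<le> g x" using g_ge(1)[of x] by linarith
  qed
  also have "\<dots> \<le> \<epsilon>" using tail assms \<open>T \<ge> s\<close> by auto
  also have "integral {s..T} (\<lambda>t. \<beta> * c) = \<bar>\<epsilon>\<bar> + 1"
    using \<open>T \<ge> s\<close> \<open>c > 0\<close> \<beta>_pos by (simp add: T_def)
  finally show False by simp
qed

text \<open>\<open>z\<close> is at most \<open>C + t\<close>, and the mean cannot fall faster than
  linearly because its slope is bounded; subtraction gives linear growth.\<close>

lemma v_le: obtains K where "K > 0" "\<And>t \<theta>. t \<ge> 0 \<Longrightarrow> \<theta> \<in> {0..pi} \<Longrightarrow> v t \<theta> \<le> K * (1 + t)"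
proof
  \<comment> \<open>\<open>R\<close> bounds \<open>\<bar>p s\<bar>\<close> for all
    \<open>s \<ge> 0\<close>: the initial value plus a bound for the total variation.\<close>
  define R where "R = \<bar>p 0\<bar> + \<bar>(\<beta> + 2) * B\<bar>"
  have q: "q t \<ge> q 0 - R * t" if "t \<ge> 0" for t
  proof -
    have "((\<lambda>t. q t + R * t) has_real_derivative p t + R) (at t)" for t
      by (auto intro!: derivative_eq_intros dq)
    moreover have "p s + R \<ge> 0" if "s \<ge> 0" for s
      using p_diff[OF that] int_g[OF that] by (auto simp: R_def)
    ultimately have "q 0 + R * 0 \<le> q t + R * t"
      using that by (intro DERIV_nonneg_imp_nondecreasing[of 0 t "\<lambda>t. q t + R * t"]) auto
    then show ?thesis by simp
  qed
  define K where "K = \<bar>C\<bar> + \<bar>q 0\<bar> / pi + 1 + R / pi"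
  have "R \<ge> 0" by (simp add: R_def)
  then show "K > 0" by (simp add: K_def add_nonneg_pos add_pos_nonneg)
  show "v t \<theta> \<le> K * (1 + t)" if "t \<ge> 0" "\<theta> \<in> {0..pi}" for t \<theta>
  proof -
    have "- q t / pi \<le> (\<bar>q 0\<bar> + R * t) / pi"
      using q[OF that(1)] by (intro divide_right_mono) auto
    then have "v t \<theta> \<le> \<bar>C\<bar> + t + \<bar>q 0\<bar> / pi + R / pi * t"
      using z_le[OF that(2), of t] by (simp add: v_def add_divide_distrib)
    also have "\<dots> \<le> K * (1 + t)"
    proof -
      have "K * (1 + t) - (\<bar>C\<bar> + t + \<bar>q 0\<bar> / pi + R / pi * t) = \<bar>C\<bar> * t + \<bar>q 0\<bar> / pi * t + 1 + R / pi"
        by (simp add: K_def algebra_simps add_divide_distrib)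
      also have "\<dots> \<ge> 0" using that \<open>R \<ge> 0\<close> by (intro add_nonneg_nonneg mult_nonneg_nonneg) auto
      finally show ?thesis by simp
    qed
    finally show ?thesis .
  qed
qed

section \<open>Energy of the oscillation\<close>

text \<open>As \<open>vt\<close> has mean zero, the integral of the square of \<open>zt\<close> is
  that of \<open>vt\<close> plus \<open>(p t)\<^sup>2 / pi\<close>. Solving the definition of
  \<open>H\<close> for the \<open>zh\<close> integral, discarding nonnegative terms and estimating
  the \<open>F\<close> integral below leaves this bound.\<close>

lemma energy_ge: "energy t \<ge> 2 * ((p t)\<^sup>2 / (2 * pi) - H t) - \<beta> * J t"
proof -
  let ?I = "\<lambda>f. integral {0..pi} f"
  have "?I (\<lambda>\<theta>. (zt t \<theta>)\<^sup>2) = ?I (\<lambda>\<theta>. (vt t \<theta>)\<^sup>2 + 2 * p t / pi * vt t \<theta> + (p t / pi)\<^sup>2)"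
    by (intro integral_cong) (simp add: vt_def power2_eq_square field_simps)
  also have "\<dots> = ?I (\<lambda>\<theta>. (vt t \<theta>)\<^sup>2) + (p t)\<^sup>2 / pi"
    by (subst integral_add; (subst integral_add)?;
        auto intro!: integrable_continuous_real continuous_intros cont_all simp: integral_v power2_eq_square)+
  finally have 1: "?I (\<lambda>\<theta>. (zt t \<theta>)\<^sup>2) = ?I (\<lambda>\<theta>. (vt t \<theta>)\<^sup>2) + (p t)\<^sup>2 / pi" .
  have 2: "?I (\<lambda>\<theta>. (vt t \<theta>)\<^sup>2) \<ge> 0"
    by (intro integral_nonneg integrable_continuous_real continuous_intros cont_all) auto
  have "(p t)\<^sup>2 / pi = 2 * ((p t)\<^sup>2 / (2 * pi))" by simp
  note 3 = 1[unfolded this]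
  show ?thesis unfolding energy_def H_def 3
    using 2 integral_F_bounds(1)[of t] b_nonneg[of t] by argo
qed

lemma energy_nonneg: "energy t \<ge> 0"
    "integral {0..pi} (\<lambda>\<theta>. (vt t \<theta>)\<^sup>2) \<le> energy t" "integral {0..pi} (\<lambda>\<theta>. (zh t \<theta>)\<^sup>2) \<le> energy t"
proof -
  have "integral {0..pi} (\<lambda>\<theta>. (vt t \<theta>)\<^sup>2) \<ge> 0" "integral {0..pi} (\<lambda>\<theta>. (zh t \<theta>)\<^sup>2) \<ge> 0"
    by (intro integral_nonneg integrable_continuous_real continuous_intros cont_all; simp)+
  then show "energy t \<ge> 0"
    "integral {0..pi} (\<lambda>\<theta>. (vt t \<theta>)\<^sup>2) \<le> energy t" "integral {0..pi} (\<lambda>\<theta>. (zh t \<theta>)\<^sup>2) \<le> energy t"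
    by (auto simp: energy_def)
qed

lemma cont_energy: "continuous_on T energy"
  unfolding energy_def[abs_def]
  by (intro continuous_intros parametric_integral_continuous cont_all)

text \<open>Half the derivative of the integral of the square of \<open>v\<close>; its own
  derivative is what testing the equation with \<open>v\<close> produces.\<close>

definition "E1 t = integral {0..pi} (\<lambda>\<theta>. v t \<theta> * vt t \<theta>)"
definition "E1' t = energy t - integral {0..pi} (\<lambda>\<theta>. v t \<theta> * (F t \<theta> * exp (2 * z t \<theta>)))
  - (v t 0 * exp (z t 0) + v t pi * exp (z t pi))"

text \<open>The equation replaces \<open>ztt\<close>, the product of \<open>v\<close> and
  \<open>zhh\<close> is integrated by parts with the boundary conditions, and \<open>p'\<close>
  drops out because \<open>v\<close> has mean zero.\<close>

lemma dE1: "(E1 has_real_derivative E1' t) (at t)"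
proof -
  let ?I = "\<lambda>f. integral {0..pi} f"
  have dv: "((\<lambda>t. v t \<theta>) has_real_derivative vt t \<theta>) (at t)"
    and dvt: "((\<lambda>t. vt t \<theta>) has_real_derivative ztt t \<theta> - p' t / pi) (at t)" if "\<theta> \<in> {0..pi}" for t \<theta>
    unfolding v_def[abs_def] vt_def[abs_def] using that
    by (auto intro!: derivative_eq_intros dz_t dzt_t dq dp)
  have cont_p': "continuous_on T p'" for T
    unfolding p'_def[abs_def] by (intro continuous_intros parametric_integral_continuous cont_all)
  have "(E1 has_real_derivative ?I (\<lambda>\<theta>. vt t \<theta> * vt t \<theta> + v t \<theta> * (ztt t \<theta> - p' t / pi))) (at t)"
    unfolding E1_def[abs_def]
    by (rule parametric_integral_has_derivative)
       (auto intro!: derivative_eq_intros dv dvt continuous_intros cont_all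
         continuous_on_compose2[OF cont_p'[of UNIV]])
  moreover have "?I (\<lambda>\<theta>. vt t \<theta> * vt t \<theta> + v t \<theta> * (ztt t \<theta> - p' t / pi)) = E1' t"
  proof -
    have "((\<lambda>\<theta>. v t \<theta> * zhh t \<theta> + zh t \<theta> * zh t \<theta>) has_integral
        (v t pi * zh t pi - v t 0 * zh t 0)) {0..pi}"
    proof (rule fundamental_theorem_of_calculus)
      show "((\<lambda>\<theta>. v t \<theta> * zh t \<theta>) has_vector_derivative (v t \<theta> * zhh t \<theta> + zh t \<theta> * zh t \<theta>))
          (at \<theta> within {0..pi})" if "\<theta> \<in> {0..pi}" for \<theta>
      proof -
        have "(v t has_real_derivative zh t \<theta>) (at \<theta> within {0..pi})"
          unfolding v_def[abs_def] using that by (auto intro!: derivative_eq_intros dz_h)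
        from DERIV_mult'[OF this dzh_h[OF that]] show ?thesis
          unfolding has_real_derivative_iff_has_vector_derivative[symmetric] by simp
      qed
    qed simp
    then have bd: "v t 0 * exp (z t 0) + v t pi * exp (z t pi)
        = ?I (\<lambda>\<theta>. v t \<theta> * zhh t \<theta> + zh t \<theta> * zh t \<theta>)"
      by (simp add: integral_unique bdry0 bdry_pi)
    \<comment> \<open>The last integral is zero; it is inserted so that the integrands agree
      pointwise.\<close>
    have "E1' t = ?I (\<lambda>\<theta>. (vt t \<theta>)\<^sup>2) + ?I (\<lambda>\<theta>. (zh t \<theta>)\<^sup>2)
        - ?I (\<lambda>\<theta>. v t \<theta> * (F t \<theta> * exp (2 * z t \<theta>)))
        - ?I (\<lambda>\<theta>. v t \<theta> * zhh t \<theta> + zh t \<theta> * zh t \<theta>) - ?I (\<lambda>\<theta>. p' t / pi * v t \<theta>)"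
      unfolding E1'_def energy_def bd by (simp add: integral_v)
    also have "\<dots> = ?I (\<lambda>\<theta>. (vt t \<theta>)\<^sup>2 + (zh t \<theta>)\<^sup>2 - v t \<theta> * (F t \<theta> * exp (2 * z t \<theta>))
        - (v t \<theta> * zhh t \<theta> + zh t \<theta> * zh t \<theta>) - p' t / pi * v t \<theta>)"
      by (subst integral_add integral_diff;
          (subst integral_add integral_diff)?;
          (subst integral_add integral_diff)?;
          auto intro!: integrable_continuous_real continuous_intros cont_all)+
    also have "\<dots> = ?I (\<lambda>\<theta>. vt t \<theta> * vt t \<theta> + v t \<theta> * (ztt t \<theta> - p' t / pi))"
      by (intro integral_cong) (simp add: eq' algebra_simps power2_eq_square)
    finally show ?thesis ..
  qed
  ultimately show ?thesis by metis
qed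

text \<open>The hypothesis on \<open>t\<close> makes \<open>F \<le> 0\<close>, so the interior term \<open>v F e\<^bsup>2z\<^esup>\<close> is positive only where \<open>v < 0\<close>;
  there \<open>- v e\<^bsup>2v\<^esup> \<le> 1\<close> leaves \<open>\<beta> e\<^bsup>2t\<^esup> e\<^bsup>2 mean z\<^esup>\<close>.\<close>

lemma E1'_ge:
  assumes "\<alpha> * exp (2 * t) \<ge> 1" "\<And>\<theta>. \<theta> \<in> {0..pi} \<Longrightarrow> v t \<theta> \<le> k"
  shows "energy t \<le> E1' t + \<beta> * J t + k * b t"
proof -
  let ?I = "\<lambda>f. integral {0..pi} f"
  have "?I (\<lambda>\<theta>. v t \<theta> * (F t \<theta> * exp (2 * z t \<theta>))) \<le> ?I (\<lambda>\<theta>. \<beta> * exp (2 * t) * exp (2 * (q t / pi)))"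
  proof (intro integral_le integrable_continuous_real continuous_intros cont_all)
    fix \<theta> assume \<theta>: "\<theta> \<in> {0..pi}"
    have "F t \<theta> \<le> 1 - \<alpha> * exp (2 * t)"
      using a_bounds[OF \<theta>] mult_right_mono[of "a \<theta>" "-\<alpha>" "exp (2 * t)"] by (simp add: F_def algebra_simps)
    then have F: "F t \<theta> \<le> 0" "- F t \<theta> \<le> \<beta> * exp (2 * t)" using assms(1) F_bounds(1)[OF \<theta>, of t] by auto
    have ve: "- v t \<theta> * exp (2 * v t \<theta>) \<le> 1"
    proof -
      \<comment> \<open>The average of exp x >= 1 + x and exp x >= 0 at x = -2v.\<close>
      have "- v t \<theta> \<le> exp (- 2 * v t \<theta>)"
        using exp_ge_add_one_self[of "- 2 * v t \<theta>"] exp_ge_zero[of "- 2 * v t \<theta>"] by linarith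
      from mult_right_mono[OF this, of "exp (2 * v t \<theta>)"] show ?thesis by (simp flip: exp_add)
    qed
    have "exp (2 * z t \<theta>) = exp (2 * (q t / pi)) * exp (2 * v t \<theta>)"
      by (simp add: v_def algebra_simps flip: exp_add)
    then have "v t \<theta> * (F t \<theta> * exp (2 * z t \<theta>))
        = (- F t \<theta> * exp (2 * (q t / pi))) * (- v t \<theta> * exp (2 * v t \<theta>))"
      by (simp add: mult_ac)
    also have "\<dots> \<le> (- F t \<theta> * exp (2 * (q t / pi))) * 1"
      using F by (intro mult_left_mono ve) (simp add: mult_nonpos_nonneg)
    also have "\<dots> \<le> \<beta> * exp (2 * t) * exp (2 * (q t / pi))"
      using mult_right_mono[OF F(2), of "exp (2 * (q t / pi))"] by simp
    finally show "v t \<theta> * (F t \<theta> * exp (2 * z t \<theta>)) \<le> \<beta> * exp (2 * t) * exp (2 * (q t / pi))" .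
  qed
  also have "\<dots> = \<beta> * (exp (2 * t) * (pi * exp (2 * (q t / pi))))" by simp
  \<comment> \<open>Jensen turns the exponential of the mean back into the integrable quantity
    \<open>J\<close>.\<close>
  also have "\<dots> \<le> \<beta> * J t"
    unfolding J_eq using \<beta>_pos by (intro mult_left_mono jensen) auto
  finally have 1: "?I (\<lambda>\<theta>. v t \<theta> * (F t \<theta> * exp (2 * z t \<theta>))) \<le> \<beta> * J t" .
  have "v t 0 * exp (z t 0) + v t pi * exp (z t pi) \<le> k * exp (z t 0) + k * exp (z t pi)"
    by (intro add_mono mult_right_mono assms(2)) auto
  then have "v t 0 * exp (z t 0) + v t pi * exp (z t pi) \<le> k * b t" by (simp add: b_def algebra_simps)
  with 1 show ?thesis by (simp add: E1'_def)
qed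

lemma z_osc:
  assumes "x \<in> {0..pi}" "y \<in> {0..pi}"
  shows "\<bar>z t y - z t x\<bar> \<le> integral {0..pi} (\<lambda>\<theta>. \<bar>zh t \<theta>\<bar>)"
proof -
  have *: "\<bar>z t y - z t x\<bar> \<le> integral {0..pi} (\<lambda>\<theta>. \<bar>zh t \<theta>\<bar>)"
    if xy: "0 \<le> x" "x \<le> y" "y \<le> pi" for x y
  proof -
    have "(zh t has_integral z t y - z t x) {x..y}"
      using xy by (intro fundamental_theorem_of_calculus)
        (auto simp: has_real_derivative_iff_has_vector_derivative[symmetric] intro: DERIV_subset[OF dz_h])
    then have "\<bar>z t y - z t x\<bar> = \<bar>integral {x..y} (zh t)\<bar>" by (simp add: integral_unique)
    also have "\<dots> \<le> integral {x..y} (\<lambda>\<theta>. \<bar>zh t \<theta>\<bar>)"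
      using xy by (intro integral_norm_bound_integral[of "zh t", unfolded real_norm_def])
        (auto intro!: integrable_continuous_real continuous_intros continuous_on_subset[OF cont_slice(3)])
    also have "\<dots> \<le> integral {0..pi} (\<lambda>\<theta>. \<bar>zh t \<theta>\<bar>)"
      using xy by (intro integral_subset_le)
        (auto intro!: integrable_continuous_real continuous_intros continuous_on_subset[OF cont_slice(3)])
    finally show ?thesis .
  qed
  show ?thesis using assms *[of x y] *[of y x] by (cases "x \<le> y") auto
qed

text \<open>A one-sided bound on the mean-zero function \<open>v\<close> bounds its \<open>L\<^sup>1\<close> norm, and \<open>z\<^sub>\<theta>\<close> bounds its sup norm;
  together they give \<open>\<integral> v\<^sup>2 \<le> 2 \<pi> k sqrt (\<pi> energy)\<close>.\<close>

lemma E1_bound: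
  assumes k: "\<And>\<theta>. \<theta> \<in> {0..pi} \<Longrightarrow> v t \<theta> \<le> k"
  shows "(E1 t) ^ 4 \<le> 4 * pi ^ 3 * k\<^sup>2 * (energy t) ^ 3"
proof -
  let ?I = "\<lambda>f. integral {0..pi} f"
  define W where "W = ?I (\<lambda>\<theta>. \<bar>zh t \<theta>\<bar>)"
  have "W \<ge> 0" unfolding W_def
    by (intro integral_nonneg integrable_continuous_real continuous_intros cont_all) auto
  have "W\<^sup>2 \<le> ?I (\<lambda>\<theta>. \<bar>zh t \<theta>\<bar>\<^sup>2) * ?I (\<lambda>\<theta>. 1\<^sup>2)"
    unfolding W_def using integral_Cauchy_Schwarz[of 0 pi "\<lambda>\<theta>. \<bar>zh t \<theta>\<bar>" "\<lambda>_. 1"]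
    by (auto intro!: continuous_intros cont_all)
  also have "\<dots> \<le> energy t * pi" using energy_nonneg(3)[of t] by simp
  finally have W2: "W\<^sup>2 \<le> energy t * pi" .
  have vW: "\<bar>v t x\<bar> \<le> W" if x: "x \<in> {0..pi}" for x
  proof -
    have s: "v t x - v t y \<le> W" "v t y - v t x \<le> W" if "y \<in> {0..pi}" for y
      using z_osc[OF that x, of t] by (auto simp: W_def v_def)
    \<comment> \<open>Averaging over \<open>y\<close> removes \<open>v t y\<close>, so the bound on
      the oscillation becomes a bound on the sup norm.\<close>
    have "?I (\<lambda>y. v t x - v t y) \<le> ?I (\<lambda>y. W)" "?I (\<lambda>y. v t y - v t x) \<le> ?I (\<lambda>y. W)"
      by (intro integral_le integrable_continuous_real continuous_intros cont_all s; simp)+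
    moreover have "?I (\<lambda>y. v t x - v t y) = pi * v t x" "?I (\<lambda>y. v t y - v t x) = - (pi * v t x)"
      by (subst integral_diff; auto intro!: integrable_continuous_real continuous_intros cont_all simp: integral_v)+
    ultimately have "pi * v t x \<le> pi * W" "pi * (- v t x) \<le> pi * W" by auto
    then show ?thesis by (simp only: mult_le_cancel_left_pos[OF pi_gt_zero] abs_le_iff)
  qed
  have k0: "k \<ge> 0"
  proof (rule ccontr)
    assume "\<not> k \<ge> 0"
    then have "?I (v t) \<le> ?I (\<lambda>_. k)"
      using k by (intro integral_le integrable_continuous_real continuous_intros cont_all) auto
    then have "0 \<le> pi * k" by (simp add: integral_v)
    with \<open>\<not> k \<ge> 0\<close> show False using pi_gt_zero by (simp add: zero_le_mult_iff)
  qed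
  \<comment> \<open>From v <= k and k >= 0 follows |v| <= 2k - v. One factor |v| is bounded this
    way, the other by \<open>W\<close>.\<close>
  have "?I (\<lambda>\<theta>. (v t \<theta>)\<^sup>2) \<le> ?I (\<lambda>\<theta>. W * (2 * k - v t \<theta>))"
  proof (intro integral_le integrable_continuous_real continuous_intros cont_all)
    fix \<theta> assume \<theta>: "\<theta> \<in> {0..pi}"
    have "(v t \<theta>)\<^sup>2 = \<bar>v t \<theta>\<bar> * \<bar>v t \<theta>\<bar>" by (simp add: power2_eq_square)
    also have "\<dots> \<le> W * (2 * k - v t \<theta>)"
      using k[OF \<theta>] k0 vW[OF \<theta>] \<open>W \<ge> 0\<close> by (intro mult_mono) auto
    finally show "(v t \<theta>)\<^sup>2 \<le> W * (2 * k - v t \<theta>)" .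
  qed
  also have "\<dots> = W * ?I (\<lambda>\<theta>. 2 * k - v t \<theta>)" by simp
  also have "?I (\<lambda>\<theta>. 2 * k - v t \<theta>) = 2 * pi * k"
    by (subst integral_diff; auto intro!: integrable_continuous_real continuous_intros cont_all simp: integral_v)
  finally have v2: "?I (\<lambda>\<theta>. (v t \<theta>)\<^sup>2) \<le> W * (2 * pi * k)" .
  have "(E1 t)\<^sup>2 \<le> ?I (\<lambda>\<theta>. (v t \<theta>)\<^sup>2) * ?I (\<lambda>\<theta>. (vt t \<theta>)\<^sup>2)"
    unfolding E1_def by (rule integral_Cauchy_Schwarz) (intro cont_all)+
  also have "\<dots> \<le> W * (2 * pi * k) * energy t"
    using \<open>W \<ge> 0\<close> k0
    by (intro mult_mono v2 energy_nonneg integral_nonneg integrable_continuous_real continuous_intros cont_all) auto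
  \<comment> \<open>A second squaring produces \<open>W\<^sup>2\<close>, which the energy
    controls.\<close>
  finally have "((E1 t)\<^sup>2)\<^sup>2 \<le> (W * (2 * pi * k) * energy t)\<^sup>2" by (intro power_mono) auto
  also have "\<dots> = W\<^sup>2 * (4 * pi\<^sup>2 * k\<^sup>2 * (energy t)\<^sup>2)" by (simp add: power2_eq_square algebra_simps)
  also have "\<dots> \<le> (energy t * pi) * (4 * pi\<^sup>2 * k\<^sup>2 * (energy t)\<^sup>2)"
    using W2 by (intro mult_right_mono) auto
  finally show ?thesis by (simp add: power2_eq_square eval_nat_numeral algebra_simps)
qed

section \<open>Blow-up of the accumulated energy\<close>

theorem no_strip_solution: False
proof -
  obtain \<delta> where \<delta>: "\<delta> > 0" "\<And>t. t \<ge> 0 \<Longrightarrow> H t \<le> pi / 2 - \<delta>" using H_gap by blast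
  obtain K where K: "K > 0" "\<And>t \<theta>. t \<ge> 0 \<Longrightarrow> \<theta> \<in> {0..pi} \<Longrightarrow> v t \<theta> \<le> K * (1 + t)" using v_le by blast
  \<comment> \<open>In order, the three bounds preserve most of the gap \<open>\<delta>\<close>,
    keep \<open>K * \<epsilon>\<close> below \<open>\<delta> / 4\<close>, and keep
    \<open>pi - \<epsilon>\<close> nonnegative.\<close>
  define \<epsilon> where "\<epsilon> = Min {\<delta> / 4, \<delta> / (4 * K), 1}"
  have \<epsilon>: "\<epsilon> > 0" "\<epsilon> \<le> \<delta> / 4" "\<epsilon> \<le> \<delta> / (4 * K)" "\<epsilon> \<le> 1" using \<delta> K by (auto simp: \<epsilon>_def)
  from \<epsilon>(3) have K\<epsilon>: "K * \<epsilon> \<le> \<delta> / 4" using K(1) by (simp add: field_simps)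
  \<comment> \<open>Beyond \<open>ln (1 / \<alpha>)\<close> and zero,
    \<open>\<alpha> * exp (2 * t) \<ge> 1\<close> holds, as \<open>E1'_ge\<close> requires.\<close>
  obtain S where S: "S \<ge> ln (1 / \<alpha>)" "S \<ge> 0"
    and tail: "\<And>T T'. S \<le> T \<Longrightarrow> T \<le> T' \<Longrightarrow> integral {T..T'} g \<le> \<epsilon>"
    using bounded_integral_tail[OF cont_g g_ge(3) int_g \<epsilon>(1)] by blast
  have \<alpha>S: "\<alpha> * exp (2 * t) \<ge> 1" if "t \<ge> S" for t
  proof -
    have "ln (1 / \<alpha>) \<le> 2 * t" using that S by auto
    then have "exp (ln (1 / \<alpha>)) \<le> exp (2 * t)" by simp
    then show ?thesis using \<alpha>_pos by (simp add: field_simps)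
  qed
  define G where "G T = integral {S..T} energy" for T
  have dG: "(G has_real_derivative energy t) (at t)" if "t > S" for t
  proof -
    have "(G has_real_derivative energy t) (at t within {S..t+1})"
      unfolding G_def using that by (intro integral_has_real_derivative cont_energy) auto
    moreover have "at t within {S..t+1} = at t" using that by (intro at_within_interior) auto
    ultimately show ?thesis by simp
  qed
  \<comment> \<open>The slope contributes at least \<open>pi / 2 - \<epsilon>\<close>, while
    \<open>H\<close> is at most \<open>pi / 2 - \<delta>\<close>; with
    \<open>\<epsilon> \<le> \<delta> / 4\<close> the doubled difference is at least
    \<open>3/2 * \<delta>\<close>.\<close>
  have e_ge: "3/2 * \<delta> - g t \<le> energy t" if "t \<ge> S" for t
  proof -
    have "pi - \<epsilon> \<le> - p t" using p_le[OF tail S(2) that] by simp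
    moreover have "pi - \<epsilon> \<ge> 0" using \<epsilon>(4) pi_gt3 by simp
    ultimately have "(pi - \<epsilon>)\<^sup>2 \<le> (p t)\<^sup>2" using power_mono[of "pi - \<epsilon>" "- p t" 2] by simp
    then have "pi\<^sup>2 - 2 * pi * \<epsilon> \<le> (p t)\<^sup>2" using zero_le_power2[of \<epsilon>]
      unfolding power2_diff by linarith
    then have "(pi\<^sup>2 - 2 * pi * \<epsilon>) / (2 * pi) \<le> (p t)\<^sup>2 / (2 * pi)" by (intro divide_right_mono) auto
    then have "pi / 2 - \<epsilon> \<le> (p t)\<^sup>2 / (2 * pi)" by (simp add: power2_eq_square diff_divide_distrib)
    then show ?thesis using energy_ge[of t] \<delta>(2)[of t] that S(2) \<epsilon>(2) g_ge(1)[of t] by argo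
  qed
  have G_ge: "G T \<ge> 3/2 * \<delta> * (T - S) - \<epsilon>" if "T \<ge> S" for T
  proof -
    have "integral {S..T} (\<lambda>t. 3/2 * \<delta> - g t) \<le> G T"
      unfolding G_def using e_ge
      by (intro integral_le integrable_continuous_real continuous_intros cont_g cont_energy) auto
    moreover have "integral {S..T} (\<lambda>t. 3/2 * \<delta> - g t) = 3/2 * \<delta> * (T - S) - integral {S..T} g"
      using that by (subst integral_diff) (auto intro!: integrable_continuous_real continuous_intros cont_g)
    ultimately show ?thesis using tail[OF order.refl that] by simp
  qed
  \<comment> \<open>\<open>E1'_ge\<close> is integrated with the single bound
    \<open>K * (1 + T)\<close> for the whole interval. The error then grows with slope
    \<open>\<delta> / 4\<close>, well below the slope \<open>3/2 * \<delta>\<close> in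
    \<open>G_ge\<close>.\<close>
  have G_le: "G T \<le> E1 T - E1 S + \<epsilon> + \<delta> / 4 * (1 + T)" if "T \<ge> S" for T
  proof -
    have "- E1 T - - E1 S \<le> integral {S..T} (\<lambda>t. (1 + K * (1 + T)) * g t - energy t)"
    proof (rule difference_le_integral[of _ _ "\<lambda>t. - E1 t" "\<lambda>t. - E1' t"])
      fix t assume t: "t \<in> {S..T}"
      show "((\<lambda>t. - E1 t) has_real_derivative - E1' t) (at t)" by (intro DERIV_minus dE1)
      have "energy t \<le> E1' t + \<beta> * J t + K * (1 + T) * b t"
      proof (rule E1'_ge)
        fix \<theta> assume "\<theta> \<in> {0..pi}"
        then have "v t \<theta> \<le> K * (1 + t)" using K(2) t S by auto
        also have "\<dots> \<le> K * (1 + T)" using t K(1) by simp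
        finally show "v t \<theta> \<le> K * (1 + T)" .
      qed (use \<alpha>S t in auto)
      also have "\<dots> \<le> E1' t + g t + K * (1 + T) * g t"
        using g_ge[of t] K(1) that S(2) by (intro add_mono mult_left_mono) auto
      finally show "- E1' t \<le> (1 + K * (1 + T)) * g t - energy t" by (simp add: algebra_simps)
    qed (use that in \<open>auto intro!: continuous_intros cont_g cont_energy\<close>)
    also have "\<dots> = (1 + K * (1 + T)) * integral {S..T} g - G T"
      unfolding G_def
      by (subst integral_diff) (auto intro!: integrable_continuous_real continuous_intros cont_g cont_energy)
    also have "\<dots> \<le> (1 + K * (1 + T)) * \<epsilon> - G T"
      using tail[OF order.refl that] K(1) that S(2) by (intro diff_right_mono mult_left_mono) auto
    also have "\<dots> = \<epsilon> + K * \<epsilon> * (1 + T) - G T" by (simp add: algebra_simps)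
    also have "\<dots> \<le> \<epsilon> + \<delta> / 4 * (1 + T) - G T"
      using K\<epsilon> that S(2) by (intro diff_right_mono add_left_mono mult_right_mono) auto
    finally show ?thesis by simp
  qed
  \<comment> \<open>From \<open>T1\<close> on, \<open>\<delta> * (t - S)\<close> outweighs the
    constants in \<open>G_ge\<close> and \<open>G_le\<close>, so \<open>G\<close> is positive and
    the error is at most half of \<open>G\<close>.\<close>
  define T1 where "T1 = S + 1 + 2 * (\<bar>E1 S\<bar> + 2 * \<epsilon> + \<delta> * (1 + S)) / \<delta>"
  have T1: "T1 > S" "T1 \<ge> 0" using \<delta>(1) S(2) \<epsilon>(1)
    by (auto simp: T1_def intro!: add_pos_nonneg divide_nonneg_pos add_nonneg_nonneg)
  have large: "G t > 0 \<and> G t \<le> 2 * E1 t" if "t \<ge> T1" for t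
  proof -
    have "\<delta> * (t - S) \<ge> \<delta> * (T1 - S)" using that \<delta>(1) by simp
    also have "\<delta> * (T1 - S) = \<delta> + 2 * (\<bar>E1 S\<bar> + 2 * \<epsilon> + \<delta> * (1 + S))"
      using \<delta>(1) by (simp add: T1_def field_simps)
    finally have *: "\<delta> * (t - S) \<ge> \<delta> + 2 * (\<bar>E1 S\<bar> + 2 * \<epsilon> + \<delta> * (1 + S))" .
    have "\<delta> * (1 + S) > 0" using \<delta> S by auto
    moreover have "\<delta> * (1 + t) = \<delta> * (t - S) + \<delta> * (1 + S)" by (simp add: algebra_simps)
    ultimately show ?thesis using * G_ge[of t] G_le[of t] that T1 \<epsilon>(1) \<delta>(1)
      by (intro conjI; simp add: mult.assoc; linarith)
  qed
  show False
  \<comment> \<open>The constant 64 is 16 from the fourth power of 2 times 4 from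
    \<open>E1_bound\<close>, applied with \<open>K * (1 + t)\<close>.\<close>
  proof (rule superlinear_growth_impossible[of T1 G energy "64 * pi ^ 3 * K\<^sup>2"])
    fix t assume t: "t \<ge> T1"
    have "(G t) ^ 4 \<le> (2 * E1 t) ^ 4" using large[OF t] by (intro power_mono) auto
    also have "\<dots> = 16 * (E1 t) ^ 4" by (simp add: power_mult_distrib)
    also have "\<dots> \<le> 16 * (4 * pi ^ 3 * (K * (1 + t))\<^sup>2 * (energy t) ^ 3)"
      using K(2) t T1 by (intro mult_left_mono E1_bound) auto
    finally show "(G t) ^ 4 \<le> 64 * pi ^ 3 * K\<^sup>2 * (1 + t)\<^sup>2 * (energy t) ^ 3"
      by (simp only: power_mult_distrib mult_ac)
  qed (use large dG T1 K(1) energy_nonneg in auto)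
qed

end

subsection \<open>Logarithmic polar coordinates\<close>

lemma vec2_expand: "(x::real^2) = x $ 1 *\<^sub>R axis 1 1 + x $ 2 *\<^sub>R axis 2 1"
  by (simp add: vec_eq_iff forall_2 axis_def)

text \<open>\<open>t\<close> is the logarithm of the radius. The expansion in basis vectors lets the
  derivative and continuity rules act on scalar coefficients.\<close>

definition polar :: "real \<Rightarrow> real \<Rightarrow> real^2" where
  "polar t \<theta> = (exp t * cos \<theta>) *\<^sub>R axis 1 1 + (exp t * sin \<theta>) *\<^sub>R axis 2 1"

lemma polar_nth [simp]: "polar t \<theta> $ 1 = exp t * cos \<theta>" "polar t \<theta> $ 2 = exp t * sin \<theta>"
  by (simp_all add: polar_def axis_def)

lemma polar_scale: "polar t \<theta> = exp t *\<^sub>R polar 0 \<theta>"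
  by (simp add: polar_def scaleR_add_right)

lemma norm_polar [simp]: "norm (polar t \<theta>) = exp t"
proof -
  have "(norm (polar 0 \<theta>))\<^sup>2 = 1"
    by (simp only: power2_norm_eq_inner inner_vec_def sum_2)
      (simp add: power2_eq_square[symmetric])
  then have "norm (polar 0 \<theta>) = 1" using norm_ge_zero[of "polar 0 \<theta>"] by (auto simp: power2_eq_1_iff simp del: norm_ge_zero)
  then show ?thesis by (subst polar_scale) simp
qed

lemma polar_in_closed: "\<theta> \<in> {0..pi} \<Longrightarrow> polar t \<theta> \<in> closed_upper_half_plane"
  by (simp add: closed_upper_half_plane_def sin_ge_zero)

lemma continuous_on_polar: "continuous_on T (\<lambda>p. polar (fst p) (snd p))"
  unfolding polar_def by (intro continuous_intros)

lemma continuous_on_polar_compose: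
  assumes "continuous_on closed_upper_half_plane f"
  shows "continuous_on (UNIV \<times> {0..pi}) (\<lambda>p. f (polar (fst p) (snd p)))"
  by (rule continuous_on_compose2[OF assms continuous_on_polar]) (auto intro!: polar_in_closed)

section \<open>Integrals in polar coordinates\<close>

text \<open>Fubini for pairs is transported along the coordinate isomorphism, which maps boxes to
  boxes of equal content.\<close>

lemma integral_real2_cbox:
  fixes f :: "real \<Rightarrow> real \<Rightarrow> real" and u v :: "real^2"
  assumes "continuous_on (UNIV \<times> {u $ 2..v $ 2}) (\<lambda>p. f (fst p) (snd p))"
  shows "integral (cbox u v) (\<lambda>x. f (x $ 1) (x $ 2))
    = integral {u $ 1..v $ 1} (\<lambda>t. integral {u $ 2..v $ 2} (f t))"
proof -
  let ?g = "\<lambda>x::real^2. (x $ 1, x $ 2)"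
  let ?h = "\<lambda>p::real\<times>real. fst p *\<^sub>R axis 1 1 + snd p *\<^sub>R axis 2 1 :: real^2"
  have h: "?h p $ 1 = fst p" "?h p $ 2 = snd p" for p by (simp_all add: axis_def)
  have hg: "?h (?g x) = x" for x using vec2_expand[of x] by simp
  have gh: "?g (?h p) = p" for p by (simp only: h prod.collapse)
  have mem: "x \<in> cbox u v \<longleftrightarrow> x $ 1 \<in> {u $ 1..v $ 1} \<and> x $ 2 \<in> {u $ 2..v $ 2}" for x u v :: "real^2"
    by (auto simp: mem_box_cart forall_2)
  have gimg: "?g ` cbox u v = cbox (?g u) (?g v)" for u v
  proof (intro equalityI subsetI)
    fix p assume "p \<in> cbox (?g u) (?g v)"
    then have "?h p \<in> cbox u v" unfolding mem h by (cases p) (auto simp: cbox_Pair_eq)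
    then show "p \<in> ?g ` cbox u v" using gh[of p] by (intro image_eqI[of _ _ "?h p"]) auto
  qed (auto simp: mem cbox_Pair_eq)
  have himg: "?h ` cbox p p' = cbox (?h p) (?h p')" for p p'
  proof -
    have "?h ` cbox p p' = ?h ` ?g ` cbox (?h p) (?h p')" unfolding gimg gh ..
    also have "\<dots> = cbox (?h p) (?h p')" unfolding image_image hg by simp
    finally show ?thesis .
  qed
  have cnt: "measure lborel (?g ` cbox u v) = 1 * measure lborel (cbox u v)" for u v
  proof (cases "cbox u v = {}")
    case True then show ?thesis by (simp only: image_empty) simp
  next
    case False
    then have "?g ` cbox u v \<noteq> {}" by simp
    then have ne: "u $ 1 \<le> v $ 1" "u $ 2 \<le> v $ 2" unfolding gimg by (auto simp: cbox_Pair_eq)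
    show ?thesis
      unfolding gimg content_Pair content_cbox_cart[OF False] UNIV_2
      using ne by simp
  qed
  have "continuous_on (cbox (?g u) (?g v)) (\<lambda>p. f (fst p) (snd p))"
    by (rule continuous_on_subset[OF assms]) (auto simp: cbox_Pair_eq)
  then have "((\<lambda>p. f (fst p) (snd p)) has_integral
      integral {u $ 1..v $ 1} (\<lambda>t. integral {u $ 2..v $ 2} (f t))) (cbox (?g u) (?g v))"
    using integral_prod_continuous[of "u $ 1" "u $ 2" "v $ 1" "v $ 2" "\<lambda>p. f (fst p) (snd p)"]
      integrable_continuous[of "?g u" "?g v" "\<lambda>p. f (fst p) (snd p)"]
    by (simp add: has_integral_iff)
  \<comment> \<open>The factor \<open>1 / 1\<close> is the reciprocal of the content ratio in
    \<open>cnt\<close>.\<close>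
  then have "((\<lambda>x. f (fst (?g x)) (snd (?g x))) has_integral
      (1 / 1) *\<^sub>R integral {u $ 1..v $ 1} (\<lambda>t. integral {u $ 2..v $ 2} (f t))) (?h ` cbox (?g u) (?g v))"
    by (intro has_integral_twiddle hg gh cnt) (use gimg himg in \<open>auto intro!: continuous_intros exI\<close>)
  then show ?thesis unfolding himg hg by (simp add: integral_unique)
qed

text \<open>The polar map is injective on the box and has Jacobian e^(2t). Its image lies in the
  closed half-plane, and enlarging the domain cannot decrease the integral of a nonnegative
  function.\<close>

lemma integral_polar_le:
  fixes f :: "real^2 \<Rightarrow> real"
  assumes cont: "continuous_on closed_upper_half_plane f"
    and nn: "\<And>x. x \<in> closed_upper_half_plane \<Longrightarrow> f x \<ge> 0"
    and int: "f absolutely_integrable_on upper_half_plane"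
  shows "integral {0..T} (\<lambda>t. integral {0..pi} (\<lambda>\<theta>. exp (2 * t) * f (polar t \<theta>)))
    \<le> integral closed_upper_half_plane f"
proof -
  define u v :: "real^2" where "u = 0" and "v = T *\<^sub>R axis 1 1 + pi *\<^sub>R axis 2 1"
  have uv: "u $ 1 = 0" "u $ 2 = 0" "v $ 1 = T" "v $ 2 = pi" by (simp_all add: u_def v_def axis_def)
  define G where "G x = polar (x $ 1) (x $ 2)" for x :: "real^2"
  define G' :: "real^2 \<Rightarrow> real^2 \<Rightarrow> real^2" where "G' x h = (exp (x $ 1) * (h $ 1 * cos (x $ 2) - h $ 2 * sin (x $ 2))) *\<^sub>R axis 1 1
    + (exp (x $ 1) * (h $ 1 * sin (x $ 2) + h $ 2 * cos (x $ 2))) *\<^sub>R axis 2 1" for x h :: "real^2"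
  have mem: "x \<in> cbox u v \<longleftrightarrow> x $ 1 \<in> {0..T} \<and> x $ 2 \<in> {0..pi}" for x :: "real^2"
    by (auto simp: mem_box_cart forall_2 uv)
  have der: "(G has_derivative G' x) (at x within cbox u v)" for x
    unfolding G_def[abs_def] polar_def G'_def[abs_def]
    by (auto intro!: derivative_eq_intros bounded_linear.has_derivative[OF bounded_linear_vec_nth]
        simp: algebra_simps)
  have det: "\<bar>det (matrix (G' x))\<bar> = exp (2 * x $ 1)" for x
  proof -
    have "det (matrix (G' x)) = (exp (x $ 1) * cos (x $ 2))\<^sup>2 + (exp (x $ 1) * sin (x $ 2))\<^sup>2"
      by (simp add: det_2 matrix_def G'_def axis_def power2_eq_square)
    also have "\<dots> = exp (x $ 1) * exp (x $ 1)"
      unfolding power_mult_distrib distrib_left[symmetric] by (simp add: power2_eq_square[of "exp _"])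
    finally show ?thesis by (simp add: exp_double power2_eq_square)
  qed
  \<comment> \<open>The norm recovers the first coordinate; the cosine, injective on
    \<open>{0..pi}\<close>, recovers the angle.\<close>
  have inj: "inj_on G (cbox u v)"
  proof (rule inj_onI)
    fix x y assume x: "x \<in> cbox u v" and y: "y \<in> cbox u v" and eq: "G x = G y"
    then have "norm (G x) = norm (G y)" by simp
    then have 1: "x $ 1 = y $ 1" by (simp add: G_def)
    moreover have "cos (x $ 2) = cos (y $ 2)"
      using arg_cong[OF eq, of "\<lambda>x. x $ 1"] 1 by (simp add: G_def)
    then have "x $ 2 = y $ 2"
      by (rule cos_inj_pi[rotated 4]) (use x[unfolded mem] y[unfolded mem] in \<open>simp_all only: atLeastAtMost_iff\<close>)
    ultimately show "x = y" by (simp add: vec_eq_iff forall_2)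
  qed
  have sub: "G ` cbox u v \<subseteq> closed_upper_half_plane"
    unfolding G_def by (auto simp: mem intro!: polar_in_closed)
  have contG: "continuous_on (UNIV \<times> {0..pi}) (\<lambda>p. exp (2 * fst p) * f (polar (fst p) (snd p)))"
    by (intro continuous_intros continuous_on_polar_compose cont)
  have "continuous_on (cbox u v) (\<lambda>x. exp (2 * fst (x $ 1, x $ 2)) * f (polar (fst (x $ 1, x $ 2)) (snd (x $ 1, x $ 2))))"
    by (rule continuous_on_compose2[OF contG, of "cbox u v" "\<lambda>x. (x $ 1, x $ 2)"])
       (auto simp: mem intro!: continuous_intros)
  then have abs: "(\<lambda>x. exp (2 * x $ 1) * f (G x)) absolutely_integrable_on cbox u v"
    by (intro absolutely_integrable_continuous) (simp add: G_def)
  define I where "I = integral (cbox u v) (\<lambda>x. exp (2 * x $ 1) * f (G x))"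
  \<comment> \<open>The change of variables theorem is about vector-valued functions, so
    \<open>f\<close> is lifted to \<open>real^1\<close>.\<close>
  have "(\<lambda>x. vec (f x) :: real^1) absolutely_integrable_on (G ` cbox u v)
      \<and> integral (G ` cbox u v) (\<lambda>x. vec (f x) :: real^1) = vec I"
  proof (subst has_absolute_integral_change_of_variables_compact[symmetric, OF compact_cbox der inj])
    have "(\<lambda>x. (vec (exp (2 * x $ 1) * f (G x)) :: real^1)) absolutely_integrable_on cbox u v"
      using abs by (simp add: absolutely_integrable_on_1_iff)
    moreover have "integral (cbox u v) (\<lambda>x. (vec (exp (2 * x $ 1) * f (G x)) :: real^1)) = vec I"
      by (simp add: integral_on_1_eq I_def)
    moreover have "\<bar>det (matrix (G' x))\<bar> *\<^sub>R vec (f (G x)) = (vec (exp (2 * x $ 1) * f (G x)) :: real^1)" for x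
      by (simp add: det vec_eq_iff)
    ultimately show "(\<lambda>x. \<bar>det (matrix (G' x))\<bar> *\<^sub>R (vec (f (G x)) :: real^1)) absolutely_integrable_on cbox u v
        \<and> integral (cbox u v) (\<lambda>x. \<bar>det (matrix (G' x))\<bar> *\<^sub>R (vec (f (G x)) :: real^1)) = vec I"
      by presburger
  qed
  then have fG: "f absolutely_integrable_on (G ` cbox u v)" "integral (G ` cbox u v) f = I"
    by (simp_all add: absolutely_integrable_on_1_iff integral_on_1_eq)
  \<comment> \<open>The boundary line is negligible, so integrability passes to the closed
    half-plane.\<close>
  have "f absolutely_integrable_on closed_upper_half_plane"
  proof (subst absolutely_integrable_spike_set_eq)
    show "negligible {x \<in> closed_upper_half_plane - upper_half_plane. f x \<noteq> 0}"
      by (rule negligible_subset[OF negligible_standard_hyperplane_cart[of 2]])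
         (auto simp: closed_upper_half_plane_def upper_half_plane_def)
    show "negligible {x \<in> upper_half_plane - closed_upper_half_plane. f x \<noteq> 0}"
      by (rule negligible_subset[OF negligible_empty])
         (auto simp: closed_upper_half_plane_def upper_half_plane_def)
  qed (rule int)
  then have "I \<le> integral closed_upper_half_plane f"
    unfolding fG(2)[symmetric] using fG(1) nn
    by (intro integral_subset_le[OF sub]) (auto simp: absolutely_integrable_on_def)
  moreover have "I = integral {0..T} (\<lambda>t. integral {0..pi} (\<lambda>\<theta>. exp (2 * t) * f (polar t \<theta>)))"
    unfolding I_def G_def
    using integral_real2_cbox[of u v "\<lambda>t \<theta>. exp (2 * t) * f (polar t \<theta>)"] contG by (simp add: uv)
  ultimately show ?thesis by simp
qed

text \<open>The substitution s = \<sigma> e^t maps into one boundary ray; the two signs of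
  \<open>\<sigma>\<close> give the two rays.\<close>

lemma integral_ray_le:
  fixes f :: "real \<Rightarrow> real"
  assumes "integrable lborel f" "\<And>x. f x \<ge> 0" "\<bar>\<sigma>\<bar> = 1"
  shows "integral {0..T} (\<lambda>t. exp t * f (\<sigma> * exp t)) \<le> integral UNIV f"
proof -
  have f: "f absolutely_integrable_on UNIV"
    using assms(1) by (simp add: set_integrable_def integrable_completion)
  let ?g = "\<lambda>t. \<sigma> * exp t"
  have "{0..T} \<in> sets lebesgue" by simp
  moreover have "(?g has_field_derivative \<sigma> * exp t) (at t within {0..T})" for t
    by (auto intro!: derivative_eq_intros)
  moreover have inj: "inj_on ?g {0..T}" using assms(3) by (auto simp: inj_on_def)
  moreover have fg: "f absolutely_integrable_on (?g ` {0..T})"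
  proof (rule set_integrable_subset[OF f])
    have "compact (?g ` {0..T})" by (intro compact_continuous_image continuous_intros) auto
    then show "?g ` {0..T} \<in> sets lebesgue" by (simp add: compact_imp_closed)
  qed auto
  ultimately have "integral {0..T} (\<lambda>t. \<bar>\<sigma> * exp t\<bar> * f (\<sigma> * exp t)) = integral (?g ` {0..T}) f"
    using has_absolute_integral_change_of_variables_1'[of "{0..T}" ?g "\<lambda>t. \<sigma> * exp t" f] by blast
  moreover have "integral (?g ` {0..T}) f \<le> integral UNIV f"
    using f fg assms(2) by (intro integral_subset_le) (auto simp: absolutely_integrable_on_def)
  ultimately show ?thesis using assms(3) by (simp add: abs_mult)
qed

section \<open>Derivatives up to the boundary and bounds on the quadratic form\<close>

lemma closure_upper_half_plane: "closure upper_half_plane = closed_upper_half_plane"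
  by (simp add: upper_half_plane_def closed_upper_half_plane_def)

lemma open_upper_half_plane: "open upper_half_plane"
  unfolding upper_half_plane_def by (intro open_Collect_less continuous_intros)

lemma closed_closed_upper_half_plane: "closed closed_upper_half_plane"
  by (metis closure_upper_half_plane closed_closure)

lemma has_derivative_partial_within:
  fixes f :: "real^2 \<Rightarrow> real"
  assumes "f differentiable_on S" "x \<in> S"
  shows "(f has_derivative (\<lambda>h. h $ 1 * partial_within S 1 f x + h $ 2 * partial_within S 2 f x)) (at x within S)"
proof -
  let ?D = "frechet_derivative f (at x within S)"
  have D: "(f has_derivative ?D) (at x within S)"
    using assms by (simp add: differentiable_on_def frechet_derivative_works)
  then have lin: "linear ?D" by (rule has_derivative_linear)
  have "?D h = h $ 1 * partial_within S 1 f x + h $ 2 * partial_within S 2 f x" for h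
    by (subst vec2_expand) (simp add: linear_add[OF lin] linear_scale[OF lin] partial_within_def)
  then have "?D = (\<lambda>h. h $ 1 * partial_within S 1 f x + h $ 2 * partial_within S 2 f x)" by blast
  with D show ?thesis by simp
qed

text \<open>A ray from the origin stays in the closed half-plane, so even along the boundary the
  derivative of \<open>f\<close> within it yields a two-sided derivative in
  \<open>t\<close>.\<close>

lemma partial_polar_t:
  assumes "f differentiable_on closed_upper_half_plane" "\<theta> \<in> {0..pi}"
  shows "((\<lambda>t. f (polar t \<theta>)) has_real_derivative
    exp t * cos \<theta> * partial_within closed_upper_half_plane 1 f (polar t \<theta>)
    + exp t * sin \<theta> * partial_within closed_upper_half_plane 2 f (polar t \<theta>)) (at t)"
proof -
  have "((\<lambda>t. polar t \<theta>) has_derivative (\<lambda>s. s *\<^sub>R polar t \<theta>)) (at t)"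
    unfolding polar_def by (auto intro!: derivative_eq_intros simp: algebra_simps)
  from has_derivative_in_compose2[OF has_derivative_partial_within[OF assms(1)] _ _ this]
  show ?thesis unfolding has_field_derivative_def
    by (rule has_derivative_eq_rhs) (use assms(2) in \<open>auto simp: polar_in_closed algebra_simps\<close>)
qed

text \<open>The circle leaves the half-plane at the end angles, hence the derivative within
  \<open>{0..pi}\<close>.\<close>

lemma partial_polar_angle:
  assumes "f differentiable_on closed_upper_half_plane" "\<theta> \<in> {0..pi}"
  shows "((\<lambda>\<theta>. f (polar t \<theta>)) has_real_derivative
    - (exp t * sin \<theta>) * partial_within closed_upper_half_plane 1 f (polar t \<theta>)
    + exp t * cos \<theta> * partial_within closed_upper_half_plane 2 f (polar t \<theta>)) (at \<theta> within {0..pi})"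
proof -
  have "((\<lambda>\<theta>. polar t \<theta>) has_derivative
      (\<lambda>s. (- s * exp t * sin \<theta>) *\<^sub>R axis 1 1 + (s * exp t * cos \<theta>) *\<^sub>R axis 2 1)) (at \<theta> within {0..pi})"
    unfolding polar_def by (auto intro!: derivative_eq_intros simp: algebra_simps)
  from has_derivative_in_compose2[OF has_derivative_partial_within[OF assms(1)] _ _ this]
  show ?thesis unfolding has_field_derivative_def
    by (rule has_derivative_eq_rhs) (use assms(2) in \<open>auto simp: polar_in_closed algebra_simps axis_def\<close>)
qed

lemma laplacian_upper_half_plane:
  fixes w :: "real^2 \<Rightarrow> real"
  assumes "smooth_within closed_upper_half_plane w" "x \<in> upper_half_plane"
  defines "D \<equiv> partial_within closed_upper_half_plane"
  shows "laplacian w x = D 1 (D 1 w) x + D 2 (D 2 w) x"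
proof -
  have at: "at y within closed_upper_half_plane = at y" if "y \<in> upper_half_plane" for y
    by (rule at_within_open_subset[OF that open_upper_half_plane])
       (auto simp: upper_half_plane_def closed_upper_half_plane_def)
  have Dw: "D i w y = partial_within UNIV i w y" if "y \<in> upper_half_plane" for i y
    by (simp add: D_def partial_within_def at[OF that])
  have "D i (D i w) x = partial_within UNIV i (partial_within UNIV i w) x" for i
  proof -
    have "D i w differentiable_on closed_upper_half_plane"
      using assms(1) unfolding smooth_within_def D_def by (auto dest: spec[of _ "[i]"])
    then have "D i w differentiable at x"
      using assms(2) at[OF assms(2)] closure_subset[of upper_half_plane]
      unfolding differentiable_on_def closure_upper_half_plane by force
    \<comment> \<open>The first derivatives agree on an open set around \<open>x\<close>, hence so
      do the second ones at \<open>x\<close>.\<close>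
    then have "frechet_derivative (D i w) (at x) = frechet_derivative (partial_within UNIV i w) (at x)"
      by (rule frechet_derivative_transform_within_open[OF _ open_upper_half_plane assms(2) Dw])
    then show ?thesis by (simp add: D_def partial_within_def at[OF assms(2)])
  qed
  then show ?thesis by (simp add: laplacian_def sum_2)
qed

text \<open>The form attains its extrema on the compact unit circle, and homogeneity of degree two
  extends the bounds to all vectors.\<close>

lemma negative_definite_bounds:
  fixes A :: "real^2^2"
  assumes "negative_definite A"
  obtains \<alpha> \<beta> where "\<alpha> > 0" "\<And>x. - \<beta> * (norm x)\<^sup>2 \<le> (A *v x) \<bullet> x" "\<And>x. (A *v x) \<bullet> x \<le> - \<alpha> * (norm x)\<^sup>2"
proof -
  define Q where "Q x = (A *v x) \<bullet> x" for x
  have Q: "continuous_on T Q" for T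
    unfolding Q_def by (intro continuous_intros matrix_vector_mult_linear_continuous_on)
  have ne: "sphere (0::real^2) 1 \<noteq> {}" by simp
  obtain x1 where x1: "norm x1 = 1" "\<And>y. norm y = 1 \<Longrightarrow> Q y \<le> Q x1"
    using continuous_attains_sup[OF compact_sphere ne Q] by auto
  obtain x2 where x2: "norm x2 = 1" "\<And>y. norm y = 1 \<Longrightarrow> Q x2 \<le> Q y"
    using continuous_attains_inf[OF compact_sphere ne Q] by auto
  have scale: "Q x = Q (x /\<^sub>R norm x) * (norm x)\<^sup>2" if "x \<noteq> 0" for x
    using that by (simp add: Q_def matrix_vector_mult_scaleR power2_eq_square field_simps)
  show thesis
  proof
    have "x1 \<noteq> 0" using x1(1) by auto
    then show "- Q x1 > 0" using assms by (simp add: negative_definite_def Q_def)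
    fix x :: "real^2"
    have "- (- Q x2) * (norm x)\<^sup>2 \<le> Q x \<and> Q x \<le> - (- Q x1) * (norm x)\<^sup>2"
    proof (cases "x = 0")
      case True then show ?thesis by (simp add: Q_def)
    next
      case False
      have "Q x2 * (norm x)\<^sup>2 \<le> Q (x /\<^sub>R norm x) * (norm x)\<^sup>2"
        "Q (x /\<^sub>R norm x) * (norm x)\<^sup>2 \<le> Q x1 * (norm x)\<^sup>2"
        using False by (auto intro!: mult_right_mono x1(2) x2(2))
      then show ?thesis by (simp only: scale[OF False] minus_minus)
    qed
    then show "- (- Q x2) * (norm x)\<^sup>2 \<le> (A *v x) \<bullet> x" "(A *v x) \<bullet> x \<le> - (- Q x1) * (norm x)\<^sup>2"
      by (auto simp: Q_def)
  qed
qed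

section \<open>From the half-plane to the strip\<close>

theorem theorem1p5:
  fixes A :: "real^2^2" and F :: "real^2 \<Rightarrow> real"
  assumes "negative_definite A"
    and "\<And>x. F x = 1 + (A *v x) \<bullet> x"
  shows "\<not> (\<exists>w :: real^2 \<Rightarrow> real.
      smooth_within closed_upper_half_plane w \<and>
      (\<forall>x\<in>upper_half_plane. - laplacian w x = F x * exp (2 * w x)) \<and>
      (\<forall>x\<in>bdry_upper_half_plane. normal_derivative w x = exp (w x)) \<and>
      (\<exists>C. \<forall>x\<in>upper_half_plane. w x \<le> C) \<and>
      set_integrable lborel upper_half_plane (\<lambda>x. F x * exp (2 * w x)) \<and>
      (\<integral>\<^sup>+x\<in>upper_half_plane. ennreal (exp (2 * w x)) \<partial>lborel) < \<infinity> \<and>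
      (\<integral>\<^sup>+x\<in>bdry_upper_half_plane. ennreal (exp (w x)) \<partial>bdry_arc_length) < \<infinity> \<and>
      (\<exists>K::real. has_bochner_integral lborel
        (\<lambda>x. indicator upper_half_plane x *\<^sub>R (F x * exp (2 * w x))) K))"
proof (rule notI, elim exE conjE)
  fix w :: "real^2 \<Rightarrow> real" and C
  let ?S = closed_upper_half_plane and ?U = upper_half_plane
  assume smooth: "smooth_within ?S w"
    and pde: "\<forall>x\<in>?U. - laplacian w x = F x * exp (2 * w x)"
    and bdry: "\<forall>x\<in>bdry_upper_half_plane. normal_derivative w x = exp (w x)"
    and w_le: "\<forall>x\<in>?U. w x \<le> C"
    and intF: "set_integrable lborel ?U (\<lambda>x. F x * exp (2 * w x))"
    and intw: "(\<integral>\<^sup>+x\<in>?U. ennreal (exp (2 * w x)) \<partial>lborel) < \<infinity>"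
    and intb: "(\<integral>\<^sup>+x\<in>bdry_upper_half_plane. ennreal (exp (w x)) \<partial>bdry_arc_length) < \<infinity>"
  obtain \<alpha> \<beta> where \<alpha>: "\<alpha> > 0" and \<alpha>\<beta>: "\<And>x. - \<beta> * (norm x)\<^sup>2 \<le> (A *v x) \<bullet> x"
      "\<And>x. (A *v x) \<bullet> x \<le> - \<alpha> * (norm x)\<^sup>2"
    using negative_definite_bounds[OF assms(1)] by blast
  define D where "D = partial_within ?S"
  have diff: "w differentiable_on ?S" "D i w differentiable_on ?S" "D j (D i w) differentiable_on ?S" for i j
    using smooth unfolding smooth_within_def D_def
    by (auto dest: spec[of _ "[]"] spec[of _ "[i]"] spec[of _ "[j, i]"])
  note cont = diff[THEN differentiable_imp_continuous_on]
  have U_S: "?U \<subseteq> ?S" using closure_subset[of ?U] by (simp add: closure_upper_half_plane)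
  have contF: "continuous_on T F" for T
    unfolding assms(2) by (intro continuous_intros matrix_vector_mult_linear_continuous_on)
  \<comment> \<open>The strip includes its two edges, so the equation and the bound on
    \<open>w\<close> are extended by continuity to the closed half-plane.\<close>
  have pde': "D 1 (D 1 w) x + D 2 (D 2 w) x = - (F x * exp (2 * w x))" if "x \<in> ?S" for x
  proof -
    have "D 1 (D 1 w) x + D 2 (D 2 w) x + F x * exp (2 * w x) = 0"
    proof (rule continuous_constant_on_closure[of ?U])
      show "continuous_on (closure ?U) (\<lambda>x. D 1 (D 1 w) x + D 2 (D 2 w) x + F x * exp (2 * w x))"
        unfolding closure_upper_half_plane by (intro continuous_intros cont contF)
      show "D 1 (D 1 w) x + D 2 (D 2 w) x + F x * exp (2 * w x) = 0" if "x \<in> ?U" for x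
        using laplacian_upper_half_plane[OF smooth that] pde that by (auto simp: D_def)
    qed (use that in \<open>simp add: closure_upper_half_plane\<close>)
    then show ?thesis by simp
  qed
  have w_le': "w x \<le> C" if "x \<in> ?S" for x
    by (rule continuous_le_on_closure[of ?U]) (use w_le that cont in \<open>auto simp: closure_upper_half_plane\<close>)
  have normal: "D 2 w x = - exp (w x)" if "x \<in> bdry_upper_half_plane" for x
  proof -
    have x: "x \<in> ?S" using that by (simp add: bdry_upper_half_plane_def closed_upper_half_plane_def)
    have lin: "linear (frechet_derivative w (at x within ?S))"
      using diff(1) x by (intro linear_frechet_derivative) (simp add: differentiable_on_def)
    have on: "outward_normal = - axis 2 1"
      by (simp add: outward_normal_def vec_eq_iff forall_2 axis_def)
    have "normal_derivative w x = - D 2 w x"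
      unfolding normal_derivative_def D_def partial_within_def on by (rule linear_neg[OF lin])
    with bdry that show ?thesis by simp
  qed

  have U_borel: "?U \<in> sets borel" using open_upper_half_plane by simp
  have abs_int: "f absolutely_integrable_on ?U" if "set_integrable lborel ?U f" for f :: "real^2 \<Rightarrow> real"
    using that by (simp add: set_integrable_def integrable_completion)
  have int1: "set_integrable lborel ?U (\<lambda>x. exp (2 * w x))"
    unfolding set_integrable_def
  proof (rule integrableI_nonneg)
    have "continuous_on ?U (\<lambda>x. exp (2 * w x))"
      by (intro continuous_intros continuous_on_subset[OF cont(1) U_S])
    then show "(\<lambda>x. indicat_real ?U x *\<^sub>R exp (2 * w x)) \<in> borel_measurable lborel"
      using borel_measurable_continuous_on_indicator[OF U_borel] by force
    have "(\<integral>\<^sup>+x. ennreal (indicat_real ?U x *\<^sub>R exp (2 * w x)) \<partial>lborel)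
        = (\<integral>\<^sup>+x\<in>?U. ennreal (exp (2 * w x)) \<partial>lborel)"
      by (intro nn_integral_cong) (auto simp: indicator_def)
    then show "(\<integral>\<^sup>+x. ennreal (indicat_real ?U x *\<^sub>R exp (2 * w x)) \<partial>lborel) < \<infinity>"
      using intw by simp
  qed auto
  \<comment> \<open>Negative definiteness gives \<alpha> |x|^2 <= 1 - F(x), so |x|^2 e^(2w) is
    dominated by a combination of the two integrable functions e^(2w) and F e^(2w).\<close>
  have int2: "set_integrable lborel ?U (\<lambda>x. (norm x)\<^sup>2 * exp (2 * w x))"
  proof (rule set_integrable_bound)
    show "set_integrable lborel ?U (\<lambda>x. (exp (2 * w x) - F x * exp (2 * w x)) / \<alpha>)"
      by (intro set_integrable_divide set_integral_diff(1) int1 intF)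
    have "continuous_on ?U (\<lambda>x. (norm x)\<^sup>2 * exp (2 * w x))"
      by (intro continuous_intros continuous_on_subset[OF cont(1) U_S])
    then show "set_borel_measurable lborel ?U (\<lambda>x. (norm x)\<^sup>2 * exp (2 * w x))"
      using borel_measurable_continuous_on_indicator[OF U_borel] by (force simp: set_borel_measurable_def)
    have "norm ((norm x)\<^sup>2 * exp (2 * w x)) \<le> norm ((exp (2 * w x) - F x * exp (2 * w x)) / \<alpha>)" for x
    proof -
      have "\<alpha> * (norm x)\<^sup>2 * exp (2 * w x) \<le> (1 - F x) * exp (2 * w x)"
        using \<alpha>\<beta>(2)[of x] by (intro mult_right_mono) (auto simp: assms(2))
      then have "(norm x)\<^sup>2 * exp (2 * w x) \<le> (exp (2 * w x) - F x * exp (2 * w x)) / \<alpha>"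
        using \<alpha> by (simp add: field_simps)
      also have "\<dots> \<le> norm ((exp (2 * w x) - F x * exp (2 * w x)) / \<alpha>)"
        by (simp only: real_norm_def abs_ge_self)
      finally show ?thesis by (simp add: abs_mult)
    qed
    then show "AE x in lborel. x \<in> ?U \<longrightarrow> norm ((norm x)\<^sup>2 * exp (2 * w x))
        \<le> norm ((exp (2 * w x) - F x * exp (2 * w x)) / \<alpha>)"
      by blast
  qed
  define u where "u s = exp (w (vector [s, 0]))" for s
  have vec0: "vector [s, 0] = (s *\<^sub>R axis 1 1 :: real^2)" for s :: real
    by (simp add: vec_eq_iff forall_2 axis_def)
  have vec0_bdry: "vector [s, 0] \<in> bdry_upper_half_plane" for s
    by (simp add: bdry_upper_half_plane_def)
  have bdry_S: "bdry_upper_half_plane \<subseteq> ?S"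
    by (auto simp: bdry_upper_half_plane_def closed_upper_half_plane_def)
  have cont_vec: "continuous_on UNIV (\<lambda>s::real. vector [s, 0] :: real^2)"
    unfolding vec0 by (intro continuous_intros)
  have cont_u: "continuous_on UNIV u" unfolding u_def
    using vec0_bdry bdry_S by (intro continuous_intros continuous_on_compose2[OF cont(1) cont_vec]) auto
  have int_u: "integrable lborel u"
  proof (rule integrableI_nonneg)
    show "u \<in> borel_measurable lborel" using cont_u by (simp add: borel_measurable_continuous_onI)
    have closed: "closed bdry_upper_half_plane"
      unfolding bdry_upper_half_plane_def by (intro closed_Collect_eq continuous_intros)
    \<comment> \<open>Continuity of \<open>w\<close> is available only on the closed half-plane, so
      measurability is obtained for its cutoff to the closed boundary line.\<close>
    have "(\<lambda>x. indicat_real bdry_upper_half_plane x *\<^sub>R exp (w x)) \<in> borel_measurable borel"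
      using closed by (intro borel_measurable_continuous_on_indicator continuous_intros
          continuous_on_subset[OF cont(1) bdry_S]) auto
    then have "(\<lambda>x. ennreal (indicat_real bdry_upper_half_plane x *\<^sub>R exp (w x))) \<in> borel_measurable borel"
      by (rule measurable_compose[OF _ measurable_ennreal])
    moreover have "ennreal (indicat_real bdry_upper_half_plane x *\<^sub>R exp (w x))
        = ennreal (exp (w x)) * indicator bdry_upper_half_plane x" for x
      by (auto simp: indicator_def)
    ultimately have "(\<lambda>x. ennreal (exp (w x)) * indicator bdry_upper_half_plane x) \<in> borel_measurable borel"
      by (simp only:)
    then have "(\<integral>\<^sup>+x\<in>bdry_upper_half_plane. ennreal (exp (w x)) \<partial>bdry_arc_length)
        = (\<integral>\<^sup>+s. ennreal (exp (w (vector [s, 0]))) * indicator bdry_upper_half_plane (vector [s, 0] :: real^2) \<partial>lborel)"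
      unfolding bdry_arc_length_def using cont_vec
      by (intro nn_integral_distr) (auto intro: borel_measurable_continuous_onI)
    then show "(\<integral>\<^sup>+s. ennreal (u s) \<partial>lborel) < \<infinity>"
      using intb vec0_bdry by (simp add: u_def)
  qed (auto simp: u_def)

  define X Y where "X t \<theta> = exp t * cos \<theta>" and "Y t \<theta> = exp t * sin \<theta>" for t \<theta> :: real
  define P where "P f t \<theta> = f (polar t \<theta>)" for f :: "real^2 \<Rightarrow> real" and t \<theta>
  have cont_P: "continuous_on ?S f \<Longrightarrow> continuous_on (UNIV \<times> {0..pi}) (\<lambda>p. P f (fst p) (snd p))" for f
    unfolding P_def by (rule continuous_on_polar_compose)
  have cont_XY: "continuous_on T (\<lambda>p. X (fst p) (snd p))" "continuous_on T (\<lambda>p. Y (fst p) (snd p))" for T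
    unfolding X_def Y_def by (intro continuous_intros)+
  have dX: "((\<lambda>t. X t \<theta>) has_real_derivative X t \<theta>) (at t)"
    "(X t has_real_derivative - Y t \<theta>) (at \<theta> within {0..pi})"
    and dY: "((\<lambda>t. Y t \<theta>) has_real_derivative Y t \<theta>) (at t)"
    "(Y t has_real_derivative X t \<theta>) (at \<theta> within {0..pi})" for t \<theta>
    unfolding X_def[abs_def] Y_def[abs_def] by (auto intro!: derivative_eq_intros)
  \<comment> \<open>In these coordinates the \<open>t\<close>-derivative is the dilation field and
    the angular derivative the rotation field.\<close>
  have dP: "((\<lambda>t. P f t \<theta>) has_real_derivative X t \<theta> * P (D 1 f) t \<theta> + Y t \<theta> * P (D 2 f) t \<theta>) (at t)"
    "(P f t has_real_derivative - Y t \<theta> * P (D 1 f) t \<theta> + X t \<theta> * P (D 2 f) t \<theta>) (at \<theta> within {0..pi})"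
    if "f differentiable_on ?S" "\<theta> \<in> {0..pi}" for f t \<theta>
    using partial_polar_t[OF that, of t] partial_polar_angle[OF that, of t]
    by (simp_all add: P_def[abs_def] X_def Y_def D_def)
  define a where "a \<theta> = (A *v polar 0 \<theta>) \<bullet> polar 0 \<theta>" for \<theta>
  have F_polar: "F (polar t \<theta>) = 1 + exp (2 * t) * a \<theta>" for t \<theta>
    by (subst polar_scale) (simp add: assms(2) a_def matrix_vector_mult_scaleR exp_double power2_eq_square)
  have XY2: "(X t \<theta>)\<^sup>2 + (Y t \<theta>)\<^sup>2 = exp (2 * t)" for t \<theta>
    unfolding X_def Y_def power_mult_distrib distrib_left[symmetric] by (simp add: exp_double)
  \<comment> \<open>The half disc corresponds to \<open>t \<le> 0\<close>; there \<open>M\<close>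
    bounds the gradient, and \<open>zt - 1\<close> is its product with a vector of length
    e^t.\<close>
  obtain M where M: "\<And>x. x \<in> ?S \<inter> cball 0 1 \<Longrightarrow> \<bar>D 1 w x\<bar> + \<bar>D 2 w x\<bar> \<le> M"
  proof -
    have "compact (?S \<inter> cball 0 1)" using closed_closed_upper_half_plane by (simp add: closed_Int_compact)
    moreover have "continuous_on (?S \<inter> cball 0 1) (\<lambda>x. \<bar>D 1 w x\<bar> + \<bar>D 2 w x\<bar>)"
      by (intro continuous_intros continuous_on_subset[OF cont(2)]) auto
    ultimately have "bounded ((\<lambda>x. \<bar>D 1 w x\<bar> + \<bar>D 2 w x\<bar>) ` (?S \<inter> cball 0 1))"
      by (intro compact_imp_bounded compact_continuous_image)
    then show thesis using that by (force simp: bounded_iff)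
  qed
  \<comment> \<open>The shift by \<open>t\<close> absorbs the Jacobians: e^(2z) dt d\<theta> is
    e^(2w) dx, and e^z dt on the edges is e^w dl.\<close>
  define z where "z t \<theta> = P w t \<theta> + t" for t \<theta>
  define zt where "zt t \<theta> = X t \<theta> * P (D 1 w) t \<theta> + Y t \<theta> * P (D 2 w) t \<theta> + 1" for t \<theta>
  define zh where "zh t \<theta> = - Y t \<theta> * P (D 1 w) t \<theta> + X t \<theta> * P (D 2 w) t \<theta>" for t \<theta>
  define ztt where "ztt t \<theta> = X t \<theta> * P (D 1 w) t \<theta> + Y t \<theta> * P (D 2 w) t \<theta>
    + X t \<theta> * (X t \<theta> * P (D 1 (D 1 w)) t \<theta> + Y t \<theta> * P (D 2 (D 1 w)) t \<theta>)
    + Y t \<theta> * (X t \<theta> * P (D 1 (D 2 w)) t \<theta> + Y t \<theta> * P (D 2 (D 2 w)) t \<theta>)" for t \<theta>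
  define zth where "zth t \<theta> = - Y t \<theta> * P (D 1 w) t \<theta> + X t \<theta> * P (D 2 w) t \<theta>
    - Y t \<theta> * (X t \<theta> * P (D 1 (D 1 w)) t \<theta> + Y t \<theta> * P (D 2 (D 1 w)) t \<theta>)
    + X t \<theta> * (X t \<theta> * P (D 1 (D 2 w)) t \<theta> + Y t \<theta> * P (D 2 (D 2 w)) t \<theta>)" for t \<theta>
  define zhh where "zhh t \<theta> = - X t \<theta> * P (D 1 w) t \<theta> - Y t \<theta> * P (D 2 w) t \<theta>
    - Y t \<theta> * (- Y t \<theta> * P (D 1 (D 1 w)) t \<theta> + X t \<theta> * P (D 2 (D 1 w)) t \<theta>)
    + X t \<theta> * (- Y t \<theta> * P (D 1 (D 2 w)) t \<theta> + X t \<theta> * P (D 2 (D 2 w)) t \<theta>)" for t \<theta>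
  note defs = z_def[abs_def] zt_def[abs_def] zh_def[abs_def] ztt_def zth_def zhh_def
  \<comment> \<open>The factor 2 allows for the two boundary rays, each estimated by the integral
    over the whole line.\<close>
  define B where "B = Max {integral ?S (\<lambda>x. exp (2 * w x)), integral ?S (\<lambda>x. (norm x)\<^sup>2 * exp (2 * w x)),
    2 * integral UNIV u}"
  have B: "integral ?S (\<lambda>x. exp (2 * w x)) \<le> B" "integral ?S (\<lambda>x. (norm x)\<^sup>2 * exp (2 * w x)) \<le> B"
    "2 * integral UNIV u \<le> B" by (auto simp: B_def)
  have exp_z: "exp (2 * z t \<theta>) = exp (2 * t) * exp (2 * w (polar t \<theta>))" for t \<theta>
    by (simp add: z_def P_def algebra_simps flip: exp_add)
  \<comment> \<open>The factors \<open>1\<close> and \<open>- 1\<close> are the values of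
    \<open>\<sigma>\<close> in \<open>integral_ray_le\<close>.\<close>
  have z0: "exp (z t 0) = exp t * u (1 * exp t)" and zpi: "exp (z t pi) = exp t * u (- 1 * exp t)" for t
    by (simp_all add: z_def P_def u_def exp_add polar_def vec0)
  have polar_bdry: "polar t 0 \<in> bdry_upper_half_plane" "polar t pi \<in> bdry_upper_half_plane" for t
    by (simp_all add: bdry_upper_half_plane_def)
  have "strip_solution z zt zh ztt zth zhh a \<alpha> \<beta> B C M"
  proof
    show "continuous_on (UNIV \<times> {0..pi}) (\<lambda>p. z (fst p) (snd p))"
      "continuous_on (UNIV \<times> {0..pi}) (\<lambda>p. zt (fst p) (snd p))"
      "continuous_on (UNIV \<times> {0..pi}) (\<lambda>p. zh (fst p) (snd p))"
      "continuous_on (UNIV \<times> {0..pi}) (\<lambda>p. ztt (fst p) (snd p))"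
      "continuous_on (UNIV \<times> {0..pi}) (\<lambda>p. zth (fst p) (snd p))"
      "continuous_on (UNIV \<times> {0..pi}) (\<lambda>p. zhh (fst p) (snd p))"
      unfolding defs by (intro continuous_intros cont_P cont_XY cont)+
    show "continuous_on {0..pi} a"
      unfolding a_def[abs_def] polar_def by (intro continuous_intros matrix_vector_mult_linear_continuous_on
        continuous_on_compose2[OF matrix_vector_mult_linear_continuous_on[of UNIV]]) auto
    show "((\<lambda>t. z t \<theta>) has_real_derivative zt t \<theta>) (at t)"
      "((\<lambda>t. zt t \<theta>) has_real_derivative ztt t \<theta>) (at t)"
      "((\<lambda>t. zh t \<theta>) has_real_derivative zth t \<theta>) (at t)"
      "(z t has_real_derivative zh t \<theta>) (at \<theta> within {0..pi})"
      "(zh t has_real_derivative zhh t \<theta>) (at \<theta> within {0..pi})" if "\<theta> \<in> {0..pi}" for t \<theta>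
      unfolding defs using that
      by (auto intro!: derivative_eq_intros dX dY dP diff simp: algebra_simps)
    show "ztt t \<theta> + zhh t \<theta> = - ((1 + exp (2 * t) * a \<theta>) * exp (2 * z t \<theta>))"
      if "\<theta> \<in> {0..pi}" for t \<theta>
    proof -
      \<comment> \<open>The first-order terms cancel, and each mixed second derivative cancels
        against itself, leaving e^(2t) times the Laplacian.\<close>
      have "ztt t \<theta> + zhh t \<theta> = ((X t \<theta>)\<^sup>2 + (Y t \<theta>)\<^sup>2) * (P (D 1 (D 1 w)) t \<theta> + P (D 2 (D 2 w)) t \<theta>)"
        unfolding ztt_def zhh_def by algebra
      also have "P (D 1 (D 1 w)) t \<theta> + P (D 2 (D 2 w)) t \<theta> = - (F (polar t \<theta>) * exp (2 * w (polar t \<theta>)))"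
        unfolding P_def by (rule pde'[OF polar_in_closed[OF that]])
      finally show ?thesis by (simp add: XY2 F_polar exp_z)
    qed
    show "zh t 0 = - exp (z t 0)" "zh t pi = exp (z t pi)" for t
      using normal[OF polar_bdry(1), of t] normal[OF polar_bdry(2), of t]
      by (simp_all add: zh_def z_def P_def X_def Y_def exp_add)
    show "- \<beta> \<le> a \<theta> \<and> a \<theta> \<le> - \<alpha>" for \<theta>
      using \<alpha>\<beta>[of "polar 0 \<theta>"] by (simp add: a_def)
    show "\<alpha> > 0" by (rule \<alpha>)
    show "integral {0..T} (\<lambda>t. integral {0..pi} (\<lambda>\<theta>. exp (2 * z t \<theta>))) \<le> B" for T
      using integral_polar_le[of "\<lambda>x. exp (2 * w x)" T] B(1) cont(1) abs_int[OF int1]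
      by (simp add: exp_z continuous_intros)
    show "integral {0..T} (\<lambda>t. integral {0..pi} (\<lambda>\<theta>. exp (2 * t) * exp (2 * z t \<theta>))) \<le> B" for T
    proof -
      \<comment> \<open>One factor e^(2t) is the Jacobian, the other is |x|^2.\<close>
      have eq: "exp (2 * t) * exp (2 * z t \<theta>)
          = exp (2 * t) * ((norm (polar t \<theta>))\<^sup>2 * exp (2 * w (polar t \<theta>)))" for t \<theta>
        by (simp only: exp_z norm_polar exp_double[of t])
      show ?thesis unfolding eq
        by (rule order.trans[OF integral_polar_le B(2)])
           (auto intro!: continuous_intros cont(1) abs_int[OF int2])
    qed
    show "integral {0..T} (\<lambda>t. exp (z t 0) + exp (z t pi)) \<le> B" for T
    proof -
      have u0: "u s \<ge> 0" for s by (simp add: u_def)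
      have "(\<lambda>t. exp t * u (\<sigma> * exp t)) integrable_on {0..T}" for \<sigma>
        by (intro integrable_continuous_real continuous_intros continuous_on_compose2[OF cont_u] subset_UNIV)
      then have "integral {0..T} (\<lambda>t. exp (z t 0) + exp (z t pi))
          = integral {0..T} (\<lambda>t. exp t * u (1 * exp t)) + integral {0..T} (\<lambda>t. exp t * u (- 1 * exp t))"
        unfolding z0 zpi by (intro integral_add)
      also have "\<dots> \<le> integral UNIV u + integral UNIV u"
        by (intro add_mono integral_ray_le int_u u0) auto
      finally show ?thesis using B(3) by simp
    qed
    show "z t \<theta> \<le> C + t" if "\<theta> \<in> {0..pi}" for t \<theta>
      using w_le'[OF polar_in_closed[OF that]] by (simp add: z_def P_def)
    show "\<bar>zt t \<theta> - 1\<bar> \<le> M * exp t" if "t \<le> 0" "\<theta> \<in> {0..pi}" for t \<theta>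
    proof -
      have "\<bar>zt t \<theta> - 1\<bar> \<le> \<bar>X t \<theta>\<bar> * \<bar>P (D 1 w) t \<theta>\<bar> + \<bar>Y t \<theta>\<bar> * \<bar>P (D 2 w) t \<theta>\<bar>"
        unfolding zt_def by (simp add: abs_triangle_ineq flip: abs_mult)
      also have "\<dots> \<le> exp t * \<bar>P (D 1 w) t \<theta>\<bar> + exp t * \<bar>P (D 2 w) t \<theta>\<bar>"
        by (intro add_mono mult_right_mono) (auto simp: X_def Y_def abs_mult)
      also have "\<dots> = exp t * (\<bar>P (D 1 w) t \<theta>\<bar> + \<bar>P (D 2 w) t \<theta>\<bar>)" by (simp add: algebra_simps)
      also have "\<dots> \<le> exp t * M"
        unfolding P_def using that by (intro mult_left_mono M) (auto simp: polar_in_closed)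
      finally show ?thesis by (simp add: mult.commute)
    qed
  qed
  then show False by (rule strip_solution.no_strip_solution)
qed

end
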